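(* Let $n\geq 1$ be an integer and let $K_{1,n}$ be the complete bipartite graph with parts of sizes $1$ and $n$. Then for every integer $k\geq 1$, $$\mathrm{reg}(J(K_{1,n})^k)=kn,$$ where $J(K_{1,n})^k$ denotes the ordinary $k$-th power of the cover ideal $J(K_{1,n})$.
   Context: Let $G$ be a finite simple graph, let $\mathbb{K}$ be a field and let $S$ be the polynomial ring over $\mathbb{K}$ whose variables are the vertices of $G$. A vertex cover of $G$ is a subset $C\subseteq V(G)$ meeting every edge of $G$; it is minimal if no proper subset of it is a vertex cover. The cover ideal of $G$ is $$J(G)=\Big(\prod_{x\in C}x \;\Big|\; C\text{ a minimal vertex cover of }G\Big)=\bigcap_{\{x,y\}\in E(G)}(x,y)\subseteq S.$$ For a nonzero homogeneous ideal $I\subseteq S$ with graded Betti numbers $\beta_{i,j}(I)$ (from the minimal graded free resolution $\cdots\to\bigoplus_jS(-j)^{\beta_{1,j}(I)}\to\bigoplus_jS(-j)^{\beta_{0,j}(I)}\to I\to 0$ of $I$), the Castelnuovo–Mumford regularity is $\mathrm{reg}(I)=\max\{j-i\mid \beta_{i,j}(I)\neq 0\}$. *)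

theory Defs
  imports
    "HOL-Library.Poly_Mapping"
    "HOL-Algebra.Ideal_Product"
    "Graph_Theory.Kuratowski"
begin

section \<open>Polynomial rings on a vertex set\<close>

type_synonym ('v, 'k) mpoly = "('v \<Rightarrow>\<^sub>0 nat) \<Rightarrow>\<^sub>0 'k"

definition var :: "'v \<Rightarrow> ('v, 'k::field) mpoly" where
  "var x = Poly_Mapping.single (Poly_Mapping.single x 1) 1"

text \<open>The polynomial ring with coefficient field \<open>'k\<close> whose variables are exactly the elements
  of \<open>V\<close>, as a subring of the polynomials in all variables of type \<open>'v\<close>.\<close>

definition poly_ring :: "'v set \<Rightarrow> ('v, 'k::field) mpoly ring" where
  "poly_ring V =
    \<lparr> carrier = {p. \<forall>m \<in> Poly_Mapping.keys p. Poly_Mapping.keys m \<subseteq> V},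
      monoid.mult = (*), one = 1, zero = 0, add = (+) \<rparr>"

definition monom_degree :: "('v \<Rightarrow>\<^sub>0 nat) \<Rightarrow> nat" where
  "monom_degree m = (\<Sum>x \<in> Poly_Mapping.keys m. Poly_Mapping.lookup m x)"

text \<open>Degrees are integers, so that shifts and differences of shifts need no side conditions;
  the zero polynomial is homogeneous of every degree.\<close>

definition homogeneous :: "int \<Rightarrow> ('v, 'k::field) mpoly \<Rightarrow> bool" where
  "homogeneous j p \<longleftrightarrow> (\<forall>m \<in> Poly_Mapping.keys p. int (monom_degree m) = j)"

definition irrelevant_ideal :: "'v set \<Rightarrow> ('v, 'k::field) mpoly set" where
  "irrelevant_ideal V = genideal (poly_ring V) (var ` V)"

lemma cring_poly_ring: "cring (poly_ring V :: ('v, 'k::field) mpoly ring)"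
proof -
  let ?C = "carrier (poly_ring V :: ('v, 'k) mpoly ring)"
  have add: "p + q \<in> ?C" if "p \<in> ?C" "q \<in> ?C" for p q
    using that Poly_Mapping.keys_add[of p q] unfolding poly_ring_def by auto
  have mult: "p * q \<in> ?C" if pq: "p \<in> ?C" "q \<in> ?C" for p q
    unfolding poly_ring_def
  proof (simp, intro ballI)
    fix m assume "m \<in> Poly_Mapping.keys (p * q)"
    then obtain a b where "m = a + b" "a \<in> Poly_Mapping.keys p" "b \<in> Poly_Mapping.keys q"
      using Poly_Mapping.keys_mult[of p q] by auto
    then show "Poly_Mapping.keys m \<subseteq> V"
      using pq Poly_Mapping.keys_add[of a b] unfolding poly_ring_def by simp blast
  qed
  have uminus: "- p \<in> ?C" if "p \<in> ?C" for p
    using that unfolding poly_ring_def by (simp add: in_keys_iff uminus_poly_mapping.rep_eq)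
  have zero_one: "0 \<in> ?C" "1 \<in> ?C"
    unfolding poly_ring_def by auto
  have ops: "monoid.mult (poly_ring V :: ('v, 'k) mpoly ring) = (*)"
      "ring.add (poly_ring V :: ('v, 'k) mpoly ring) = (+)"
      "monoid.one (poly_ring V :: ('v, 'k) mpoly ring) = 1"
      "ring.zero (poly_ring V :: ('v, 'k) mpoly ring) = 0"
    unfolding poly_ring_def by simp_all
  show ?thesis
  proof (rule cringI)
    show "abelian_group (poly_ring V :: ('v, 'k) mpoly ring)"
    proof (rule abelian_groupI)
      fix p assume "p \<in> ?C"
      then have "- p \<in> ?C" by (rule uminus)
      then show "\<exists>q \<in> ?C. q \<oplus>\<^bsub>poly_ring V\<^esub> p = \<zero>\<^bsub>poly_ring V\<^esub>"
        unfolding ops by (rule bexI[rotated]) simp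
    qed (simp_all add: ops add zero_one ac_simps)
    show "comm_monoid (poly_ring V :: ('v, 'k) mpoly ring)"
      by (rule comm_monoidI) (simp_all add: ops mult zero_one ac_simps)
  qed (simp add: ops distrib_right)
qed


section \<open>Cover ideals\<close>

text \<open>Simple graphs are those of the entry \<open>Graph_Theory\<close>: finite digraphs without loops and
  multiple arcs in which every edge is represented by its two orientations.\<close>

definition vertex_cover :: "('v, 'e) pre_digraph \<Rightarrow> 'v set \<Rightarrow> bool" where
  "vertex_cover G C \<longleftrightarrow> C \<subseteq> verts G \<and> (\<forall>(x, y) \<in> arcs_ends G. x \<in> C \<or> y \<in> C)"

definition minimal_vertex_cover :: "('v, 'e) pre_digraph \<Rightarrow> 'v set \<Rightarrow> bool" where
  "minimal_vertex_cover G C \<longleftrightarrow> vertex_cover G C \<and> (\<forall>D. D \<subset> C \<longrightarrow> \<not> vertex_cover G D)"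

definition cover_ideal :: "('v, 'e) pre_digraph \<Rightarrow> ('v, 'k::field) mpoly set" where
  "cover_ideal G = genideal (poly_ring (verts G)) {\<Prod>x\<in>C. var x | C. minimal_vertex_cover G C}"


section \<open>Minimal graded free resolutions and regularity\<close>

text \<open>Elements of the free module \<open>S\<^sup>r\<close> over \<open>S = poly_ring V\<close>.\<close>

definition free_module :: "'v set \<Rightarrow> nat \<Rightarrow> (nat \<Rightarrow> ('v, 'k::field) mpoly) set" where
  "free_module V r = {v. (\<forall>l<r. v l \<in> carrier (poly_ring V)) \<and> (\<forall>l\<ge>r. v l = 0)}"

text \<open>The data of a complex \<open>\<dots> \<rightarrow> F 1 \<rightarrow> F 0 \<rightarrow> S\<close> of graded free modules of finite rank: if
  \<open>shifts R i = [d\<^sub>1, \<dots>, d\<^sub>r]\<close>, then \<open>F i\<close> is the direct sum of the \<open>S(-d\<^sub>l)\<close>. The \<open>l\<close>-th basis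
  vector of \<open>F 0\<close> is mapped to \<open>aug R l\<close>, and the \<open>l\<close>-th basis vector of \<open>F (i + 1)\<close> to the vector
  with entries \<open>diff R i l 0, diff R i l 1, \<dots>\<close> of \<open>F i\<close>.\<close>

record 'p graded_complex =
  shifts :: "nat \<Rightarrow> int list"
  aug :: "nat \<Rightarrow> 'p"
  diff :: "nat \<Rightarrow> nat \<Rightarrow> nat \<Rightarrow> 'p"

definition rnk :: "('v, 'k::field) mpoly graded_complex \<Rightarrow> nat \<Rightarrow> nat" where
  "rnk R i = length (shifts R i)"

definition aug_map :: "('v, 'k::field) mpoly graded_complex \<Rightarrow> (nat \<Rightarrow> ('v, 'k) mpoly) \<Rightarrow> ('v, 'k) mpoly"
  where "aug_map R v = (\<Sum>l<rnk R 0. v l * aug R l)"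

definition diff_map ::
  "('v, 'k::field) mpoly graded_complex \<Rightarrow> nat \<Rightarrow> (nat \<Rightarrow> ('v, 'k) mpoly) \<Rightarrow> nat \<Rightarrow> ('v, 'k) mpoly"
  where "diff_map R i v = (\<lambda>m. if m < rnk R i then \<Sum>l<rnk R (Suc i). v l * diff R i l m else 0)"

text \<open>The entries of a matrix defining a degree-preserving map
  \<open>\<Oplus>\<^sub>l S(-d\<^sub>l) \<rightarrow> \<Oplus>\<^sub>m S(-e\<^sub>m)\<close> are homogeneous of degree \<open>d\<^sub>l - e\<^sub>m\<close>.\<close>

definition graded_maps :: "'v set \<Rightarrow> ('v, 'k::field) mpoly graded_complex \<Rightarrow> bool" where
  "graded_maps V R \<longleftrightarrow>
    (\<forall>l<rnk R 0. aug R l \<in> carrier (poly_ring V) \<and> homogeneous (shifts R 0 ! l) (aug R l)) \<and>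
    (\<forall>i. \<forall>l<rnk R (Suc i). \<forall>m<rnk R i. diff R i l m \<in> carrier (poly_ring V) \<and>
      homogeneous (shifts R (Suc i) ! l - shifts R i ! m) (diff R i l m))"

definition graded_free_resolution ::
  "'v set \<Rightarrow> ('v, 'k::field) mpoly set \<Rightarrow> ('v, 'k) mpoly graded_complex \<Rightarrow> bool" where
  "graded_free_resolution V I R \<longleftrightarrow>
    graded_maps V R \<and>
    aug_map R ` free_module V (rnk R 0) = I \<and>
    {v \<in> free_module V (rnk R 0). aug_map R v = 0} =
      diff_map R 0 ` free_module V (rnk R 1) \<and>
    (\<forall>i. {v \<in> free_module V (rnk R (Suc i)). diff_map R i v = (\<lambda>_. 0)} =
      diff_map R (Suc i) ` free_module V (rnk R (Suc (Suc i))))"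

text \<open>Minimality: \<open>F (i + 1)\<close> is mapped into \<open>\<mm> F i\<close>, where \<open>\<mm>\<close> is the ideal generated by the
  variables.\<close>

definition minimal_graded_free_resolution ::
  "'v set \<Rightarrow> ('v, 'k::field) mpoly set \<Rightarrow> ('v, 'k) mpoly graded_complex \<Rightarrow> bool" where
  "minimal_graded_free_resolution V I R \<longleftrightarrow>
    graded_free_resolution V I R \<and>
    (\<forall>i. \<forall>l<rnk R (Suc i). \<forall>m<rnk R i. diff R i l m \<in> irrelevant_ideal V)"

text \<open>For a finite set \<open>V\<close>, every homogeneous ideal has a minimal graded free resolution, and it
  is unique up to isomorphism of graded complexes; the number of summands \<open>S(-j)\<close> in homological
  degree \<open>i\<close> is therefore independent of the choice made here.\<close>

definition graded_betti :: "'v set \<Rightarrow> ('v, 'k::field) mpoly set \<Rightarrow> nat \<Rightarrow> int \<Rightarrow> nat" where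
  "graded_betti V I i j =
    count_list (shifts (SOME R. minimal_graded_free_resolution V I R) i) j"

text \<open>The regularity of a nonzero homogeneous ideal (as a module, not of its quotient ring); the
  set is then finite, by Hilbert's syzygy theorem, and nonempty.\<close>

definition regularity :: "'v set \<Rightarrow> ('v, 'k::field) mpoly set \<Rightarrow> int" where
  "regularity V I = Max {j - int i | i j. graded_betti V I i j \<noteq> 0}"

end

theory Submission
  imports Defs
begin

text \<open>The minimal vertex covers of a star are its centre and its set of leaves, so the cover ideal is
  \<open>(a, b)\<close> with \<open>a\<close> a variable and \<open>b\<close> the product of the \<open>n\<close> leaves. As \<open>b\<close> is a nonzerodivisor
  modulo \<open>a\<close>, the power \<open>(a, b)\<^sup>k\<close> has a resolution of length one with generators \<open>a\<^sup>l b\<^sup>k\<^sup>-\<^sup>l\<close> and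
  linking syzygies \<open>a e\<^sub>l - b e\<^sub>l\<^sub>+\<^sub>1\<close>. Both kinds of summands contribute \<open>l + n (k - l)\<close> to the
  regularity, and the maximum \<open>k n\<close> is attained at \<open>l = 0\<close>.

  That the shifts do not depend on the chosen minimal resolution follows by comparing two of them:
  the composite of graded comparison maps in both directions is homotopic to the identity, hence
  equal to it modulo the variables. So each diagonal entry contains a product of two homogeneous
  entries with nonzero constant term, which forces the corresponding shifts to agree.\<close>

section \<open>Homogeneous polynomials and ideals\<close>

abbreviation const_term :: "('v, 'k::field) mpoly \<Rightarrow> 'k" where
  "const_term p \<equiv> Poly_Mapping.lookup p 0"

section \<open>Ring operations, ideals and constant terms\<close>

lemma poly_ring_simps [simp]:
  "x \<otimes>\<^bsub>poly_ring V\<^esub> y = x * y" "x \<oplus>\<^bsub>poly_ring V\<^esub> y = x + y"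
  "\<one>\<^bsub>poly_ring V\<^esub> = 1" "\<zero>\<^bsub>poly_ring V\<^esub> = 0"
  by (simp_all add: poly_ring_def)

interpretation poly_ring: cring "poly_ring V :: ('v, 'k::field) mpoly ring" for V
  by (rule cring_poly_ring)

lemma poly_ring_closed:
  fixes p q :: "('v, 'k::field) mpoly"
  shows "0 \<in> carrier (poly_ring V :: ('v, 'k) mpoly ring)"
    and "1 \<in> carrier (poly_ring V :: ('v, 'k) mpoly ring)"
    and "p \<in> carrier (poly_ring V) \<Longrightarrow> q \<in> carrier (poly_ring V) \<Longrightarrow> p + q \<in> carrier (poly_ring V)"
    and "p \<in> carrier (poly_ring V) \<Longrightarrow> q \<in> carrier (poly_ring V) \<Longrightarrow> p * q \<in> carrier (poly_ring V)"
    and "p \<in> carrier (poly_ring V) \<Longrightarrow> - p \<in> carrier (poly_ring V)"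
    and "p \<in> carrier (poly_ring V) \<Longrightarrow> q \<in> carrier (poly_ring V) \<Longrightarrow> p - q \<in> carrier (poly_ring V)"
    and "p \<in> carrier (poly_ring V) \<Longrightarrow> p ^ n \<in> carrier (poly_ring V)"
proof -
  show 1: "0 \<in> carrier (poly_ring V :: ('v, 'k) mpoly ring)"
    "1 \<in> carrier (poly_ring V :: ('v, 'k) mpoly ring)"
    using poly_ring.zero_closed[of V] poly_ring.one_closed[of V] by auto
  show add: "p + q \<in> carrier (poly_ring V)"
    if "p \<in> carrier (poly_ring V)" "q \<in> carrier (poly_ring V)" for p q :: "('v, 'k) mpoly"
    using poly_ring.a_closed[OF that] by simp
  show mult: "p * q \<in> carrier (poly_ring V)"
    if "p \<in> carrier (poly_ring V)" "q \<in> carrier (poly_ring V)" for p q :: "('v, 'k) mpoly"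
    using poly_ring.m_closed[OF that] by simp
  show uminus: "- p \<in> carrier (poly_ring V)"
    if "p \<in> carrier (poly_ring V)" for p :: "('v, 'k) mpoly"
    using that by (simp add: poly_ring_def in_keys_iff)
  show "p - q \<in> carrier (poly_ring V)"
    if "p \<in> carrier (poly_ring V)" "q \<in> carrier (poly_ring V)"
    using add[OF that(1) uminus[OF that(2)]] by simp
  show "p ^ n \<in> carrier (poly_ring V)" if "p \<in> carrier (poly_ring V)"
    using that by (induction n) (auto intro: mult 1)
qed

lemma poly_ring_sum_closed:
  fixes f :: "'a \<Rightarrow> ('v, 'k::field) mpoly"
  assumes "\<And>x. x \<in> A \<Longrightarrow> f x \<in> carrier (poly_ring V)"
  shows "sum f A \<in> carrier (poly_ring V)"
  using assms by (induction A rule: infinite_finite_induct) (auto intro: poly_ring_closed)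

text \<open>Negatives are multiples by \<open>-1\<close>, so closure under sums and under multiples
  by ring elements already gives an additive subgroup.\<close>

lemma poly_ring_idealI:
  fixes I :: "('v, 'k::field) mpoly set"
  assumes "I \<subseteq> carrier (poly_ring V)" "0 \<in> I"
    and "\<And>p q. p \<in> I \<Longrightarrow> q \<in> I \<Longrightarrow> p + q \<in> I"
    and "\<And>p q. p \<in> carrier (poly_ring V) \<Longrightarrow> q \<in> I \<Longrightarrow> p * q \<in> I"
  shows "ideal I (poly_ring V)"
proof (rule idealI)
  show "ring (poly_ring V :: ('v, 'k) mpoly ring)" ..
  show "subgroup I (add_monoid (poly_ring V))"
  proof (rule poly_ring.add.subgroupI)
    fix p assume p: "p \<in> I"
    then have "p \<in> carrier (poly_ring V)" using assms(1) by blast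
    then have "\<ominus>\<^bsub>poly_ring V\<^esub> p = (\<ominus>\<^bsub>poly_ring V\<^esub> \<one>\<^bsub>poly_ring V\<^esub>) \<otimes>\<^bsub>poly_ring V\<^esub> p"
      by (simp only: poly_ring.l_minus poly_ring.one_closed poly_ring.l_one)
    also have "\<dots> \<in> I"
      using assms(4)[OF _ p] by (simp del: poly_ring_simps(3))
    finally show "\<ominus>\<^bsub>poly_ring V\<^esub> p \<in> I" .
  qed (use assms in auto)
next
  fix p x :: "('v, 'k) mpoly" assume px: "p \<in> I" "x \<in> carrier (poly_ring V)"
  from assms(4)[OF px(2,1)]
  show "x \<otimes>\<^bsub>poly_ring V\<^esub> p \<in> I" "p \<otimes>\<^bsub>poly_ring V\<^esub> x \<in> I"
    by (simp_all add: mult.commute)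
qed

text \<open>Exponents are natural numbers, so \<open>a + b = 0\<close> forces
  \<open>a = b = 0\<close>: the constant term of a product comes only from the constant terms of its
  factors.\<close>

lemma const_term_mult_nonzero:
  fixes p q :: "('v, 'k::field) mpoly"
  assumes "const_term (p * q) \<noteq> 0"
  shows "const_term p \<noteq> 0" "const_term q \<noteq> 0"
proof -
  have "0 \<in> Poly_Mapping.keys (p * q)"
    using assms by (simp add: in_keys_iff)
  then obtain a b where ab: "a + b = 0" "a \<in> Poly_Mapping.keys p" "b \<in> Poly_Mapping.keys q"
    using keys_mult[of p q] by fastforce
  from ab(1) have "Poly_Mapping.lookup a x + Poly_Mapping.lookup b x = 0" for x
    by (metis lookup_add lookup_zero)
  then have "a = 0" "b = 0" by (auto intro!: poly_mapping_eqI)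
  with ab show "const_term p \<noteq> 0" "const_term q \<noteq> 0" by (simp_all add: in_keys_iff)
qed

text \<open>The polynomials with zero constant term form an ideal containing the variables.
  Minimality of a resolution enters the comparison argument in this form.\<close>

lemma irrelevant_ideal_const_term:
  fixes p :: "('v, 'k::field) mpoly"
  assumes "p \<in> irrelevant_ideal V"
  shows "const_term p = 0"
proof -
  let ?I = "{p \<in> carrier (poly_ring V). const_term p = 0} :: ('v, 'k) mpoly set"
  have "ideal ?I (poly_ring V)"
  proof (rule poly_ring_idealI)
    fix p q :: "('v, 'k) mpoly" assume "p \<in> carrier (poly_ring V)" "q \<in> ?I"
    then show "p * q \<in> ?I"
      using const_term_mult_nonzero(2)[of p q] by (auto intro: poly_ring_closed)
  qed (auto simp: lookup_add intro: poly_ring_closed)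
  moreover have "Poly_Mapping.single x (Suc 0) \<noteq> 0" for x :: 'v
    by (metis keys_single keys_zero insert_not_empty nat.distinct(1))
  then have "var ` V \<subseteq> ?I"
    by (auto simp: var_def poly_ring_def lookup_single when_def)
  ultimately have "irrelevant_ideal V \<subseteq> ?I"
    unfolding irrelevant_ideal_def by (rule poly_ring.genideal_minimal)
  with assms show ?thesis by blast
qed

lemma var_irrelevant: "x \<in> V \<Longrightarrow> (var x :: ('v, 'k::field) mpoly) \<in> irrelevant_ideal V"
  unfolding irrelevant_ideal_def
  by (rule subsetD[OF poly_ring.genideal_self]) (auto simp: var_def poly_ring_def)

lemma ideal_irrelevant_ideal: "ideal (irrelevant_ideal V :: ('v, 'k::field) mpoly set) (poly_ring V)"
  unfolding irrelevant_ideal_def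
  by (rule poly_ring.genideal_ideal) (auto simp: var_def poly_ring_def)

section \<open>Degrees and homogeneous polynomials\<close>

lemma monom_degree_add: "monom_degree (a + b) = monom_degree a + monom_degree b"
  unfolding monom_degree_def by (rule setsum_keys_plus_distrib) simp_all

lemma homogeneous_0 [simp]: "homogeneous j 0"
  by (simp add: homogeneous_def)

lemma homogeneous_uminus: "homogeneous j p \<Longrightarrow> homogeneous j (- p)"
  by (simp add: homogeneous_def in_keys_iff)

lemma homogeneous_add: "homogeneous j p \<Longrightarrow> homogeneous j q \<Longrightarrow> homogeneous j (p + q)"
  using keys_add[of p q] by (auto simp: homogeneous_def)

lemma homogeneous_sum: "(\<And>x. x \<in> A \<Longrightarrow> homogeneous j (f x)) \<Longrightarrow> homogeneous j (sum f A)"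
  by (induction A rule: infinite_finite_induct) (auto intro: homogeneous_add)

lemma homogeneous_mult:
  assumes "homogeneous i p" "homogeneous j q" "d = i + j"
  shows "homogeneous d (p * q)"
  using assms keys_mult[of p q] by (fastforce simp: homogeneous_def monom_degree_add)

lemma homogeneous_power: "homogeneous i p \<Longrightarrow> homogeneous (int n * i) (p ^ n)"
proof (induction n)
  case 0
  then show ?case by (auto simp: homogeneous_def monom_degree_def)
next
  case (Suc n)
  then show ?case by (auto intro!: homogeneous_mult simp: algebra_simps)
qed

lemma homogeneous_const_term: "homogeneous j p \<Longrightarrow> const_term p \<noteq> 0 \<Longrightarrow> j = 0"
  by (force simp: homogeneous_def in_keys_iff[symmetric] monom_degree_def)

section \<open>Homogeneous components\<close>

definition hom_component :: "int \<Rightarrow> ('v, 'k::field) mpoly \<Rightarrow> ('v, 'k) mpoly" where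
  "hom_component j = Poly_Mapping.mapp (\<lambda>m c. c when int (monom_degree m) = j)"

lemma lookup_hom_component:
  "Poly_Mapping.lookup (hom_component j p) m =
    (Poly_Mapping.lookup p m when int (monom_degree m) = j)"
  by (auto simp: hom_component_def lookup_mapp when_def in_keys_iff)

lemma keys_hom_component:
  "Poly_Mapping.keys (hom_component j p) = {m \<in> Poly_Mapping.keys p. int (monom_degree m) = j}"
  by (auto simp: in_keys_iff lookup_hom_component when_def split: if_splits)

lemma homogeneous_hom_component: "homogeneous j (hom_component j p)"
  by (simp add: homogeneous_def keys_hom_component)

lemma hom_component_closed:
  "p \<in> carrier (poly_ring V) \<Longrightarrow> hom_component j p \<in> carrier (poly_ring V)"
  by (simp add: poly_ring_def keys_hom_component)

lemma hom_component_add: "hom_component j (p + q) = hom_component j p + hom_component j q"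
  by (rule poly_mapping_eqI) (simp add: lookup_hom_component lookup_add when_add_distrib)

lemma hom_component_sum: "hom_component j (sum f A) = (\<Sum>x\<in>A. hom_component j (f x))"
proof -
  have "hom_component j 0 = 0"
    by (rule poly_mapping_eqI) (simp add: lookup_hom_component)
  then show ?thesis
    by (induction A rule: infinite_finite_induct) (simp_all add: hom_component_add)
qed

lemma hom_component_homogeneous: "homogeneous j p \<Longrightarrow> hom_component j p = p"
  by (rule poly_mapping_eqI) (auto simp: lookup_hom_component when_def homogeneous_def in_keys_iff)

text \<open>The rest \<open>r\<close> of \<open>p\<close> has no monomial of degree
  \<open>j - d\<close>, so \<open>r * q\<close> has none of degree \<open>j\<close>. If
  \<open>j - d\<close> is negative, both sides vanish.\<close>

lemma hom_component_mult:
  assumes "homogeneous d q"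
  shows "hom_component j (p * q) = hom_component (j - d) p * q"
proof -
  define r where "r = p - hom_component (j - d) p"
  have "hom_component j (r * q) = 0"
  proof (rule poly_mapping_eqI)
    fix m
    have "m \<notin> Poly_Mapping.keys (r * q)" if "int (monom_degree m) = j"
    proof
      assume "m \<in> Poly_Mapping.keys (r * q)"
      then obtain a b where ab: "m = a + b" "a \<in> Poly_Mapping.keys r" "b \<in> Poly_Mapping.keys q"
        using keys_mult[of r q] by auto
      then have "int (monom_degree a) = j - d"
        using that assms by (force simp: homogeneous_def monom_degree_add)
      with ab(2) show False
        by (simp add: r_def in_keys_iff lookup_minus lookup_hom_component)
    qed
    then show "Poly_Mapping.lookup (hom_component j (r * q)) m = Poly_Mapping.lookup 0 m"
      by (auto simp: lookup_hom_component when_def in_keys_iff)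
  qed
  moreover have "p * q = hom_component (j - d) p * q + r * q"
    by (simp add: r_def algebra_simps)
  moreover have "hom_component j (hom_component (j - d) p * q) = hom_component (j - d) p * q"
    by (intro hom_component_homogeneous homogeneous_mult[OF homogeneous_hom_component assms]) simp
  ultimately show ?thesis by (simp add: hom_component_add)
qed

lemma poly_ring_idealD:
  fixes I :: "('v, 'k::field) mpoly set"
  assumes "ideal I (poly_ring V)"
  shows "p \<in> I \<Longrightarrow> p \<in> carrier (poly_ring V)" "0 \<in> I"
    and "p \<in> I \<Longrightarrow> q \<in> I \<Longrightarrow> p + q \<in> I"
    and "p \<in> carrier (poly_ring V) \<Longrightarrow> q \<in> I \<Longrightarrow> p * q \<in> I"
proof -
  interpret ideal I "poly_ring V" by (rule assms)
  show "p \<in> I \<Longrightarrow> p \<in> carrier (poly_ring V)" by (rule Icarr)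
  show "0 \<in> I" using zero_closed by simp
  show "p \<in> I \<Longrightarrow> q \<in> I \<Longrightarrow> p + q \<in> I" using a_closed[of p q] by simp
  show "p \<in> carrier (poly_ring V) \<Longrightarrow> q \<in> I \<Longrightarrow> p * q \<in> I" using I_l_closed[of q p] by simp
qed

lemma poly_ring_ideal_sum:
  fixes f :: "'a \<Rightarrow> ('v, 'k::field) mpoly"
  assumes "ideal I (poly_ring V)" "\<And>x. x \<in> A \<Longrightarrow> f x \<in> I"
  shows "sum f A \<in> I"
  using assms(2)
  by (induction A rule: infinite_finite_induct) (auto intro: poly_ring_idealD[OF assms(1)])

text \<open>This is the ideal quotient \<open>I : Q\<close>. It allows products of two ideals to be
  controlled on generators, one factor at a time.\<close>

lemma colon_ideal:
  fixes I :: "('v, 'k::field) mpoly set"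
  assumes I: "ideal I (poly_ring V)"
  shows "ideal {p \<in> carrier (poly_ring V). \<forall>q\<in>Q. p * q \<in> I} (poly_ring V)"
  by (rule poly_ring_idealI)
    (auto simp: distrib_right mult.assoc intro: poly_ring_closed poly_ring_idealD[OF I])


section \<open>Comparison of graded free resolutions\<close>

definition lin :: "nat \<Rightarrow> (nat \<Rightarrow> nat \<Rightarrow> ('v, 'k::field) mpoly) \<Rightarrow> (nat \<Rightarrow> ('v, 'k) mpoly) \<Rightarrow> nat \<Rightarrow> ('v, 'k) mpoly"
  where "lin r A v = (\<lambda>m. \<Sum>l<r. v l * A l m)"

definition unit_vec :: "nat \<Rightarrow> nat \<Rightarrow> ('v, 'k::field) mpoly" where
  "unit_vec l = (\<lambda>m. if m = l then 1 else 0)"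

text \<open>Homogeneity of degree \<open>d\<close> in the direct sum of the \<open>S(-t_m)\<close>:
  a basis vector of degree \<open>t ! m\<close> needs a coefficient of degree
  \<open>d - t ! m\<close>. A negative difference forces the entry to be zero.\<close>

definition hom_vec :: "int list \<Rightarrow> int \<Rightarrow> (nat \<Rightarrow> ('v, 'k::field) mpoly) \<Rightarrow> bool" where
  "hom_vec t d v \<longleftrightarrow> (\<forall>m<length t. homogeneous (d - t ! m) (v m))"

lemma lin_lin: "lin s B (lin r A v) = lin r (\<lambda>l. lin s B (A l)) v"
proof
  fix m
  have "lin s B (lin r A v) m = (\<Sum>j<s. \<Sum>l<r. v l * A l j * B j m)"
    by (simp add: lin_def sum_distrib_right)
  also have "\<dots> = (\<Sum>l<r. \<Sum>j<s. v l * A l j * B j m)"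
    by (rule sum.swap)
  also have "\<dots> = lin r (\<lambda>l. lin s B (A l)) v m"
    by (simp add: lin_def sum_distrib_left mult.assoc)
  finally show "lin s B (lin r A v) m = lin r (\<lambda>l. lin s B (A l)) v m" .
qed

lemma lin_cong: "(\<And>l. l < r \<Longrightarrow> A l = B l) \<Longrightarrow> lin r A v = lin r B v"
  by (simp add: lin_def)

lemma lin_zero [simp]: "lin r A (\<lambda>_. 0) = (\<lambda>_. 0)"
  by (simp add: lin_def)

lemma lin_diff_vec: "lin r A (\<lambda>m. v m - w m) = (\<lambda>m. lin r A v m - lin r A w m)"
  by (simp add: lin_def left_diff_distrib sum_subtractf)

lemma lin_diff_rows: "lin r (\<lambda>l m. A l m - B l m) v = (\<lambda>m. lin r A v m - lin r B v m)"
  by (simp add: lin_def right_diff_distrib sum_subtractf)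

lemma lin_unit_vec: "l < r \<Longrightarrow> lin r A (unit_vec l) = A l"
  by (simp add: lin_def unit_vec_def if_distrib[of "\<lambda>x. x * _"] cong: if_cong)

lemma lin_unit_rows: "v \<in> free_module V r \<Longrightarrow> lin r unit_vec v = v"
  by (rule ext) (simp add: lin_def unit_vec_def free_module_def if_distrib[of "\<lambda>x. _ * x"] cong: if_cong)

lemma unit_vec_closed: "l < r \<Longrightarrow> unit_vec l \<in> free_module V r"
  by (simp add: unit_vec_def free_module_def poly_ring_closed)

lemma zero_free_module: "(\<lambda>_. 0) \<in> free_module V r"
  by (simp add: free_module_def poly_ring_closed)

lemma diff_free_module:
  "v \<in> free_module V r \<Longrightarrow> w \<in> free_module V r \<Longrightarrow> (\<lambda>m. v m - w m) \<in> free_module V r"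
  by (auto simp: free_module_def intro: poly_ring_closed)

lemma lin_closed:
  assumes "\<And>l. l < r \<Longrightarrow> A l \<in> free_module V s" "v \<in> free_module V r"
  shows "lin r A v \<in> free_module V s"
  using assms by (auto simp: free_module_def lin_def intro!: poly_ring_sum_closed poly_ring_closed)

lemma hom_vec_lin:
  assumes "hom_vec s d v" "\<And>l. l < length s \<Longrightarrow> hom_vec t (s ! l) (A l)"
  shows "hom_vec t d (lin (length s) A v)"
  unfolding hom_vec_def lin_def
proof (intro allI impI homogeneous_sum)
  fix m l assume "m < length t" "l \<in> {..<length s}"
  then show "homogeneous (d - t ! m) (v l * A l m)"
    using assms by (intro homogeneous_mult[of "d - s ! l" _ "s ! l - t ! m"]) (auto simp: hom_vec_def)
qed

text \<open>\<open>diff\<close> is arbitrary outside the ranks; cutting it off makes each row an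
  element of the free module, so that the differential becomes an instance of
  \<open>lin\<close>.\<close>

definition bd :: "('v, 'k::field) mpoly graded_complex \<Rightarrow> nat \<Rightarrow> nat \<Rightarrow> nat \<Rightarrow> ('v, 'k) mpoly" where
  "bd R i l = (\<lambda>m. if m < rnk R i then diff R i l m else 0)"

lemma diff_map_lin: "diff_map R i v = lin (rnk R (Suc i)) (bd R i) v"
  by (rule ext) (simp add: diff_map_def lin_def bd_def)

definition boundaries :: "'v set \<Rightarrow> ('v, 'k::field) mpoly graded_complex \<Rightarrow> nat \<Rightarrow> (nat \<Rightarrow> ('v, 'k) mpoly) set" where
  "boundaries V R i = diff_map R i ` free_module V (rnk R (Suc i))"

lemma aug_map_lin: "aug_map R (lin r A v) = (\<Sum>l<r. v l * aug_map R (A l))"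
proof -
  have "aug_map R (lin r A v) = (\<Sum>j<rnk R 0. \<Sum>l<r. v l * A l j * aug R j)"
    by (simp add: aug_map_def lin_def sum_distrib_right)
  also have "\<dots> = (\<Sum>l<r. \<Sum>j<rnk R 0. v l * A l j * aug R j)"
    by (rule sum.swap)
  finally show ?thesis by (simp add: aug_map_def sum_distrib_left mult.assoc)
qed

lemma aug_map_diff: "aug_map R (\<lambda>m. v m - w m) = aug_map R v - aug_map R w"
  by (simp add: aug_map_def left_diff_distrib sum_subtractf)

lemma aug_map_unit_vec: "l < rnk R 0 \<Longrightarrow> aug_map R (unit_vec l) = aug R l"
  by (simp add: aug_map_def unit_vec_def if_distrib[of "\<lambda>x. x * _"] cong: if_cong)

text \<open>Matrices of degree-preserving maps from the sum of the \<open>S(-s_l)\<close> to the sum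
  of the \<open>S(-t_m)\<close>.\<close>

definition graded_rows where
  "graded_rows V s t A \<longleftrightarrow>
    (\<forall>l<length s. A l \<in> free_module V (length t) \<and> hom_vec t (s ! l) (A l))"

lemma graded_rows_lin_closed:
  "graded_rows V s t A \<Longrightarrow> v \<in> free_module V (length s) \<Longrightarrow> lin (length s) A v \<in> free_module V (length t)"
  by (rule lin_closed) (auto simp: graded_rows_def)

definition hom_vec_component :: "int list \<Rightarrow> int \<Rightarrow> (nat \<Rightarrow> ('v, 'k::field) mpoly) \<Rightarrow> nat \<Rightarrow> ('v, 'k) mpoly" where
  "hom_vec_component s d v = (\<lambda>l. if l < length s then hom_component (d - s ! l) (v l) else 0)"

lemma hom_vec_component:
  assumes "v \<in> free_module V (length s)"
  shows "hom_vec_component s d v \<in> free_module V (length s)"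
    and "hom_vec s d (hom_vec_component s d v)"
  using assms
  by (auto simp: hom_vec_component_def free_module_def hom_vec_def
      intro: hom_component_closed homogeneous_hom_component)

text \<open>A degree-preserving map commutes with taking homogeneous components. One coordinate of
  the target is treated at a time: \<open>t\<close> is its shift, or 0 for the augmentation into
  \<open>S\<close>.\<close>

lemma sum_hom_vec_component:
  assumes "\<And>l. l < length s \<Longrightarrow> homogeneous (s ! l - t) (f l)"
    and "homogeneous (d - t) (\<Sum>l<length s. v l * f l)"
  shows "(\<Sum>l<length s. hom_vec_component s d v l * f l) = (\<Sum>l<length s. v l * f l)"
proof -
  have "(\<Sum>l<length s. v l * f l) = hom_component (d - t) (\<Sum>l<length s. v l * f l)"
    using assms(2) by (simp add: hom_component_homogeneous)
  also have "\<dots> = (\<Sum>l<length s. hom_vec_component s d v l * f l)"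
    unfolding hom_component_sum
  proof (rule sum.cong)
    fix l assume "l \<in> {..<length s}"
    then show "hom_component (d - t) (v l * f l) = hom_vec_component s d v l * f l"
      using hom_component_mult[OF assms(1), of l "d - t" "v l"] by (simp add: hom_vec_component_def)
  qed simp
  finally show ?thesis by simp
qed

lemma graded_mapsD:
  assumes "graded_maps V R"
  shows "l < rnk R 0 \<Longrightarrow> homogeneous (shifts R 0 ! l) (aug R l)"
    and "graded_rows V (shifts R (Suc i)) (shifts R i) (bd R i)"
  using assms
  by (auto simp: graded_maps_def graded_rows_def hom_vec_def free_module_def bd_def rnk_def)

text \<open>The differential preserves degrees, so any preimage of \<open>w\<close> may be replaced
  by its component of degree \<open>d\<close>.\<close>

lemma homogeneous_boundary_lift:
  assumes R: "graded_maps V R" and w: "w \<in> boundaries V R i" "hom_vec (shifts R i) d w"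
  obtains v where "v \<in> free_module V (rnk R (Suc i))" "hom_vec (shifts R (Suc i)) d v"
    "diff_map R i v = w"
proof -
  let ?s = "shifts R (Suc i)"
  obtain v where v: "v \<in> free_module V (length ?s)" "w = diff_map R i v"
    using w(1) by (auto simp: boundaries_def rnk_def)
  have "diff_map R i (hom_vec_component ?s d v) = w"
  proof
    fix m
    show "diff_map R i (hom_vec_component ?s d v) m = w m"
    proof (cases "m < rnk R i")
      case True
      then have "homogeneous (d - shifts R i ! m) (w m)"
        using w(2) by (simp add: hom_vec_def rnk_def)
      with True R show ?thesis
        unfolding v(2) diff_map_def rnk_def
        by (simp, intro sum_hom_vec_component[where t = "shifts R i ! m"])
          (auto simp: graded_maps_def rnk_def)
    qed (simp add: v(2) diff_map_def)
  qed
  with hom_vec_component[OF v(1)] that show ?thesis unfolding rnk_def by blast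
qed

lemma homogeneous_aug_lift:
  assumes R: "graded_maps V R" and p: "p \<in> aug_map R ` free_module V (rnk R 0)" "homogeneous d p"
  obtains v where "v \<in> free_module V (rnk R 0)" "hom_vec (shifts R 0) d v" "aug_map R v = p"
proof -
  let ?s = "shifts R 0"
  obtain v where v: "v \<in> free_module V (length ?s)" "p = aug_map R v"
    using p(1) by (auto simp: rnk_def)
  have "aug_map R (hom_vec_component ?s d v) = p"
    using p(2) R unfolding v(2) aug_map_def rnk_def
    by (intro sum_hom_vec_component[where t = 0]) (auto simp: graded_maps_def rnk_def)
  with hom_vec_component[OF v(1)] that show ?thesis unfolding rnk_def by blast
qed

section \<open>Exactness and chain maps between resolutions\<close>

lemma free_resolutionD:
  assumes "graded_free_resolution V I R"
  shows "graded_maps V R" "aug_map R ` free_module V (rnk R 0) = I"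
    and "v \<in> boundaries V R 0 \<longleftrightarrow> v \<in> free_module V (rnk R 0) \<and> aug_map R v = 0"
    and "v \<in> boundaries V R (Suc i) \<longleftrightarrow>
      v \<in> free_module V (rnk R (Suc i)) \<and> diff_map R i v = (\<lambda>_. 0)"
proof -
  from assms show "graded_maps V R" "aug_map R ` free_module V (rnk R 0) = I"
    by (simp_all add: graded_free_resolution_def)
  from assms have "{v \<in> free_module V (rnk R 0). aug_map R v = 0} = boundaries V R 0"
    "{v \<in> free_module V (rnk R (Suc i)). diff_map R i v = (\<lambda>_. 0)} = boundaries V R (Suc i)"
    by (simp_all add: graded_free_resolution_def boundaries_def)
  then show "v \<in> boundaries V R 0 \<longleftrightarrow> v \<in> free_module V (rnk R 0) \<and> aug_map R v = 0"
    "v \<in> boundaries V R (Suc i) \<longleftrightarrow>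
      v \<in> free_module V (rnk R (Suc i)) \<and> diff_map R i v = (\<lambda>_. 0)"
    by blast+
qed

text \<open>One degree of a graded chain map, reduced to what the construction of the next degree
  uses: boundaries go to boundaries.\<close>

definition chain_component where
  "chain_component V R R' i A \<longleftrightarrow> graded_rows V (shifts R i) (shifts R' i) A \<and>
    (\<forall>v \<in> boundaries V R i. lin (rnk R i) A v \<in> boundaries V R' i)"

text \<open>Both augmentations have image \<open>I\<close>, so each basis vector can be sent to a
  homogeneous preimage of its generator. The resulting map respects the augmentations, hence their
  kernels, which are the boundaries.\<close>

lemma chain_component_0:
  assumes R: "graded_free_resolution V I R" and R': "graded_free_resolution V I R'"
  obtains A where "chain_component V R R' 0 A"
    "\<And>v. v \<in> free_module V (rnk R 0) \<Longrightarrow> aug_map R' (lin (rnk R 0) A v) = aug_map R v"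
proof -
  have "\<exists>w. w \<in> free_module V (rnk R' 0) \<and> hom_vec (shifts R' 0) (shifts R 0 ! l) w \<and>
      aug_map R' w = aug R l" if l: "l < rnk R 0" for l
  proof -
    have "aug R l \<in> aug_map R' ` free_module V (rnk R' 0)"
      using free_resolutionD(2)[OF R] free_resolutionD(2)[OF R'] unit_vec_closed[OF l]
        aug_map_unit_vec[OF l] by (metis imageI)
    then show ?thesis
      using homogeneous_aug_lift[OF free_resolutionD(1)[OF R'], of "aug R l"]
        graded_mapsD(1)[OF free_resolutionD(1)[OF R] l] by metis
  qed
  then obtain A where A: "\<And>l. l < rnk R 0 \<Longrightarrow> A l \<in> free_module V (rnk R' 0) \<and>
      hom_vec (shifts R' 0) (shifts R 0 ! l) (A l) \<and> aug_map R' (A l) = aug R l"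
    by metis
  then have rows: "graded_rows V (shifts R 0) (shifts R' 0) A"
    by (simp add: graded_rows_def rnk_def)
  have aug: "aug_map R' (lin (rnk R 0) A v) = aug_map R v" for v
    using A by (simp add: aug_map_lin aug_map_def[of R])
  have "lin (rnk R 0) A v \<in> boundaries V R' 0" if "v \<in> boundaries V R 0" for v
    using that graded_rows_lin_closed[OF rows] aug[of v]
    by (simp add: free_resolutionD(3)[OF R] free_resolutionD(3)[OF R'] rnk_def)
  with rows aug that show ?thesis unfolding chain_component_def by blast
qed

text \<open>\<open>A\<close> sends the boundary of a basis vector to a boundary, whose homogeneous
  preimage serves as the row of \<open>A'\<close>. By commutation \<open>A'\<close> preserves
  cycles, which are the boundaries by exactness.\<close>

lemma chain_component_Suc:
  assumes R: "graded_free_resolution V I R" and R': "graded_free_resolution V I R'"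
    and A: "chain_component V R R' i A"
  obtains A' where "chain_component V R R' (Suc i) A'"
    "\<And>v. diff_map R' i (lin (rnk R (Suc i)) A' v) = lin (rnk R i) A (diff_map R i v)"
proof -
  have rows_bd: "graded_rows V (shifts R (Suc i)) (shifts R i) (bd R i)"
    by (rule graded_mapsD(2)[OF free_resolutionD(1)[OF R]])
  have "\<exists>w. w \<in> free_module V (rnk R' (Suc i)) \<and> hom_vec (shifts R' (Suc i)) (shifts R (Suc i) ! l) w \<and>
      diff_map R' i w = lin (rnk R i) A (bd R i l)" if l: "l < rnk R (Suc i)" for l
  proof -
    have "bd R i l \<in> boundaries V R i"
      using unit_vec_closed[OF l, of V] lin_unit_vec[OF l, of "bd R i"]
      unfolding boundaries_def diff_map_lin by (metis imageI)
    then have "lin (rnk R i) A (bd R i l) \<in> boundaries V R' i"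
      using A by (simp add: chain_component_def)
    moreover have "hom_vec (shifts R' i) (shifts R (Suc i) ! l) (lin (rnk R i) A (bd R i l))"
      unfolding rnk_def using A rows_bd l
      by (intro hom_vec_lin[of "shifts R i"]) (auto simp: chain_component_def graded_rows_def rnk_def)
    ultimately show ?thesis
      using homogeneous_boundary_lift[OF free_resolutionD(1)[OF R']] by metis
  qed
  then obtain A' where A': "\<And>l. l < rnk R (Suc i) \<Longrightarrow> A' l \<in> free_module V (rnk R' (Suc i)) \<and>
      hom_vec (shifts R' (Suc i)) (shifts R (Suc i) ! l) (A' l) \<and>
      diff_map R' i (A' l) = lin (rnk R i) A (bd R i l)"
    by metis
  then have rows: "graded_rows V (shifts R (Suc i)) (shifts R' (Suc i)) A'"
    by (simp add: graded_rows_def rnk_def)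
  have comm: "diff_map R' i (lin (rnk R (Suc i)) A' v) = lin (rnk R i) A (diff_map R i v)" for v
  proof -
    have "diff_map R' i (lin (rnk R (Suc i)) A' v) = lin (rnk R (Suc i)) (\<lambda>l. diff_map R' i (A' l)) v"
      by (simp add: diff_map_lin lin_lin)
    also have "\<dots> = lin (rnk R (Suc i)) (\<lambda>l. lin (rnk R i) A (bd R i l)) v"
      by (rule lin_cong) (simp add: A')
    finally show ?thesis by (simp add: diff_map_lin lin_lin)
  qed
  have "lin (rnk R (Suc i)) A' v \<in> boundaries V R' (Suc i)" if "v \<in> boundaries V R (Suc i)" for v
    using that graded_rows_lin_closed[OF rows] comm[of v]
    by (simp add: free_resolutionD(4)[OF R] free_resolutionD(4)[OF R'] rnk_def)
  with rows comm that show ?thesis unfolding chain_component_def by blast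
qed

section \<open>Homotopy between the composite comparison map and the identity\<close>

lemma boundary_lift_rows:
  assumes "\<And>l. l < r \<Longrightarrow> w l \<in> boundaries V R i"
  obtains H where "\<And>l. l < r \<Longrightarrow> H l \<in> free_module V (rnk R (Suc i))"
    "\<And>v. diff_map R i (lin r H v) = lin r w v"
proof -
  have "\<exists>x. x \<in> free_module V (rnk R (Suc i)) \<and> diff_map R i x = w l" if "l < r" for l
    using assms[OF that] by (auto simp: boundaries_def)
  then obtain H where H: "\<And>l. l < r \<Longrightarrow> H l \<in> free_module V (rnk R (Suc i)) \<and> diff_map R i (H l) = w l"
    by metis
  then have "diff_map R i (lin r H v) = lin r w v" for v
    by (simp add: diff_map_lin lin_lin cong: lin_cong)
  with H that show ?thesis by blast
qed

text \<open>In a minimal resolution all entries of the differentials have zero constant term, and so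
  have their linear combinations.\<close>

lemma boundary_const_term:
  assumes "minimal_graded_free_resolution V I R" "v \<in> boundaries V R i"
  shows "const_term (v m) = 0"
proof -
  obtain u where u: "v = diff_map R i u"
    using assms(2) by (auto simp: boundaries_def)
  have "const_term (u l * diff R i l m) = 0" if "l < rnk R (Suc i)" "m < rnk R i" for l
  proof -
    have "diff R i l m \<in> irrelevant_ideal V"
      using assms(1) that by (simp add: minimal_graded_free_resolution_def)
    then show ?thesis
      using const_term_mult_nonzero(2)[of "u l" "diff R i l m"] irrelevant_ideal_const_term by blast
  qed
  then show ?thesis by (simp add: u diff_map_def lookup_sum)
qed

text \<open>The homotopy between the composite chain map and the identity is only recorded through its
  component \<open>H\<close> in one degree, whose defining property needs to be known on boundaries only; this
  makes the step from \<open>i\<close> to \<open>Suc i\<close> self-contained.\<close>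

lemma resolution_comparison:
  assumes minR: "minimal_graded_free_resolution V I R" and R': "graded_free_resolution V I R'"
  shows "\<exists>A B H. chain_component V R R' i A \<and> chain_component V R' R i B \<and>
    (\<forall>l<rnk R i. H l \<in> free_module V (rnk R (Suc i))) \<and>
    (\<forall>v \<in> boundaries V R i. diff_map R i (lin (rnk R i) H v) =
      (\<lambda>m. lin (rnk R' i) B (lin (rnk R i) A v) m - v m)) \<and>
    (\<forall>l<rnk R i. \<forall>m. const_term (lin (rnk R' i) B (A l) m - unit_vec l m) = 0)"
proof (induction i)
  have R: "graded_free_resolution V I R"
    using minR by (simp add: minimal_graded_free_resolution_def)
  case 0
  obtain A where A: "chain_component V R R' 0 A"
    "\<And>v. v \<in> free_module V (rnk R 0) \<Longrightarrow> aug_map R' (lin (rnk R 0) A v) = aug_map R v"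
    using chain_component_0[OF R R'] by blast
  obtain B where B: "chain_component V R' R 0 B"
    "\<And>v. v \<in> free_module V (rnk R' 0) \<Longrightarrow> aug_map R (lin (rnk R' 0) B v) = aug_map R' v"
    using chain_component_0[OF R' R] by blast
  have A_closed: "lin (rnk R 0) A v \<in> free_module V (rnk R' 0)" if "v \<in> free_module V (rnk R 0)" for v
    using graded_rows_lin_closed[of V "shifts R 0" _ A v] A(1) that by (simp add: chain_component_def rnk_def)
  have B_closed: "lin (rnk R' 0) B v \<in> free_module V (rnk R 0)" if "v \<in> free_module V (rnk R' 0)" for v
    using graded_rows_lin_closed[of V "shifts R' 0" _ B v] B(1) that by (simp add: chain_component_def rnk_def)
  \<comment> \<open>The row of the composite minus the identity. Both maps respect the augmentation,
    so it is a cycle and therefore a boundary.\<close>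
  define w where "w l = (\<lambda>m. lin (rnk R' 0) B (A l) m - unit_vec l m)" for l
  have w: "w l \<in> boundaries V R 0" if l: "l < rnk R 0" for l
  proof -
    have u: "unit_vec l \<in> free_module V (rnk R 0)" by (rule unit_vec_closed[OF l])
    have "A l \<in> free_module V (rnk R' 0)" "aug_map R' (A l) = aug_map R (unit_vec l)"
      using A_closed[OF u] A(2)[OF u] by (simp_all add: lin_unit_vec l)
    then show ?thesis
      unfolding free_resolutionD(3)[OF R] w_def using u
      by (auto simp: aug_map_diff B(2) intro: diff_free_module B_closed)
  qed
  obtain H where H: "\<And>l. l < rnk R 0 \<Longrightarrow> H l \<in> free_module V (rnk R (Suc 0))"
    "\<And>v. diff_map R 0 (lin (rnk R 0) H v) = lin (rnk R 0) w v"
    using boundary_lift_rows[of "rnk R 0" w V R 0] w by blast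
  have "lin (rnk R 0) w v = (\<lambda>m. lin (rnk R' 0) B (lin (rnk R 0) A v) m - v m)"
    if "v \<in> boundaries V R 0" for v
    using that unfolding w_def lin_diff_rows
    by (simp add: lin_lin lin_unit_rows[of v V] free_resolutionD(3)[OF R])
  moreover have "const_term (w l m) = 0" if "l < rnk R 0" for l m
    using boundary_const_term[OF minR w[OF that]] .
  ultimately show ?case
    using A(1) B(1) H unfolding w_def by (intro exI[of _ A] exI[of _ B] exI[of _ H]) simp
next
  have R: "graded_free_resolution V I R"
    using minR by (simp add: minimal_graded_free_resolution_def)
  case (Suc i)
  then obtain A B H where IH: "chain_component V R R' i A" "chain_component V R' R i B"
    "\<And>l. l < rnk R i \<Longrightarrow> H l \<in> free_module V (rnk R (Suc i))"
    "\<And>v. v \<in> boundaries V R i \<Longrightarrow> diff_map R i (lin (rnk R i) H v) =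
      (\<lambda>m. lin (rnk R' i) B (lin (rnk R i) A v) m - v m)"
    by blast
  let ?r = "rnk R (Suc i)" and ?r' = "rnk R' (Suc i)"
  obtain A' where A': "chain_component V R R' (Suc i) A'"
    "\<And>v. diff_map R' i (lin ?r A' v) = lin (rnk R i) A (diff_map R i v)"
    using chain_component_Suc[OF R R' IH(1)] by blast
  obtain B' where B': "chain_component V R' R (Suc i) B'"
    "\<And>v. diff_map R i (lin ?r' B' v) = lin (rnk R' i) B (diff_map R' i v)"
    using chain_component_Suc[OF R' R IH(2)] by blast
  have A'_closed: "A' l \<in> free_module V ?r'" if "l < ?r" for l
    using A'(1) that by (simp add: chain_component_def graded_rows_def rnk_def)
  have B'_closed: "lin ?r' B' v \<in> free_module V ?r" if "v \<in> free_module V ?r'" for v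
    using graded_rows_lin_closed[of V "shifts R' (Suc i)" _ B' v] B'(1) that
    by (simp add: chain_component_def rnk_def)
  have bd: "bd R i l \<in> boundaries V R i" "bd R i l \<in> free_module V (rnk R i)"
    "diff_map R i (unit_vec l) = bd R i l" if l: "l < ?r" for l
  proof -
    show 1: "diff_map R i (unit_vec l) = bd R i l"
      by (simp add: diff_map_lin lin_unit_vec l)
    then show "bd R i l \<in> boundaries V R i"
      using unit_vec_closed[OF l, of V] unfolding boundaries_def by (metis imageI)
    show "bd R i l \<in> free_module V (rnk R i)"
      using graded_mapsD(2)[OF free_resolutionD(1)[OF R], of i] l by (simp add: graded_rows_def rnk_def)
  qed
  \<comment> \<open>The usual correction by the previous homotopy: applying the differential to the
    composite minus the identity gives the same as applying it to \<open>H\<close> of the boundary,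
    so \<open>w l\<close> is a cycle.\<close>
  define w where "w l = (\<lambda>m. lin ?r' B' (A' l) m - unit_vec l m - lin (rnk R i) H (bd R i l) m)" for l
  have w: "w l \<in> boundaries V R (Suc i)" if l: "l < ?r" for l
  proof -
    have "lin (rnk R i) H (bd R i l) \<in> free_module V ?r"
      using lin_closed[OF IH(3) bd(2)[OF l]] by simp
    then have closed: "w l \<in> free_module V ?r"
      unfolding w_def by (intro diff_free_module B'_closed A'_closed unit_vec_closed l)
    have "diff_map R' i (A' l) = lin (rnk R i) A (bd R i l)"
      using A'(2)[of "unit_vec l"] by (simp add: lin_unit_vec l bd(3)[OF l])
    then have "diff_map R i (w l) = (\<lambda>_. 0)"
      using B'(2)[of "A' l"] IH(4)[OF bd(1)[OF l]] bd(3)[OF l]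
      unfolding w_def diff_map_lin lin_diff_vec by simp
    with closed show ?thesis by (simp add: free_resolutionD(4)[OF R])
  qed
  obtain H' where H': "\<And>l. l < ?r \<Longrightarrow> H' l \<in> free_module V (rnk R (Suc (Suc i)))"
    "\<And>v. diff_map R (Suc i) (lin ?r H' v) = lin ?r w v"
    using boundary_lift_rows[of ?r w V R "Suc i"] w by blast
  have "lin ?r w v = (\<lambda>m. lin ?r' B' (lin ?r A' v) m - v m)" if v: "v \<in> boundaries V R (Suc i)" for v
  proof -
    have v': "v \<in> free_module V ?r" "lin ?r (bd R i) v = (\<lambda>_. 0)"
      using v by (simp_all add: free_resolutionD(4)[OF R] diff_map_lin)
    \<comment> \<open>On a boundary the inner differential vanishes and takes the \<open>H\<close>
      term with it; this is where the restriction to boundaries pays off.\<close>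
    have "lin ?r (\<lambda>l. lin (rnk R i) H (bd R i l)) v = (\<lambda>_. 0)"
      using v'(2) lin_lin[of "rnk R i" H ?r "bd R i" v] by simp
    then show ?thesis
      unfolding w_def lin_diff_rows by (simp add: lin_lin lin_unit_rows[OF v'(1)])
  qed
  moreover have "const_term (lin ?r' B' (A' l) m - unit_vec l m) = 0" if l: "l < ?r" for l m
  proof -
    have "const_term (bd R i l j * H j m) = 0" for j
      using const_term_mult_nonzero(1) boundary_const_term[OF minR bd(1)[OF l]] by blast
    then have "const_term (lin (rnk R i) H (bd R i l) m) = 0"
      by (simp add: lin_def lookup_sum)
    with boundary_const_term[OF minR w[OF l], of m] show ?thesis
      by (simp add: w_def lookup_minus)
  qed
  ultimately show ?case
    using A'(1) B'(1) H' by (intro exI[of _ A'] exI[of _ B'] exI[of _ H']) simp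
qed

text \<open>Sets of shifts, without multiplicities, suffice because the regularity only asks which
  Betti numbers are nonzero.\<close>

lemma minimal_resolution_shifts_subset:
  assumes "minimal_graded_free_resolution V I R" "graded_free_resolution V I R'"
  shows "set (shifts R i) \<subseteq> set (shifts R' i)"
proof
  fix d assume "d \<in> set (shifts R i)"
  then obtain l where l: "l < rnk R i" "d = shifts R i ! l"
    by (metis in_set_conv_nth rnk_def)
  obtain A B where A: "chain_component V R R' i A" and B: "chain_component V R' R i B"
    and id: "const_term (lin (rnk R' i) B (A l) l - unit_vec l l) = 0"
    using resolution_comparison[OF assms, of i] l(1) by blast
  \<comment> \<open>The diagonal entry of the composite has constant term 1, so some summand has a
    nonzero one. Its homogeneous factor \<open>A l m\<close> then has degree 0, which equates two
    shifts.\<close>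
  from id have "(\<Sum>m<rnk R' i. const_term (A l m * B m l)) = 1"
    by (simp add: lin_def unit_vec_def lookup_minus lookup_sum)
  then obtain m where m: "m < rnk R' i" "const_term (A l m * B m l) \<noteq> 0"
    by (metis (no_types, lifting) lessThan_iff sum.neutral zero_neq_one)
  have "homogeneous (shifts R i ! l - shifts R' i ! m) (A l m)"
    using A l(1) m(1) by (simp add: chain_component_def graded_rows_def hom_vec_def rnk_def)
  with const_term_mult_nonzero(1)[OF m(2)] have "d = shifts R' i ! m"
    using homogeneous_const_term l(2) by fastforce
  with m(1) show "d \<in> set (shifts R' i)" by (simp add: rnk_def)
qed

text \<open>The resolution chosen by \<open>SOME\<close> is itself minimal, so the inclusion of
  shifts applies in both directions.\<close>

lemma graded_betti_nonzero_iff: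
  assumes "minimal_graded_free_resolution V I R"
  shows "graded_betti V I i j \<noteq> 0 \<longleftrightarrow> j \<in> set (shifts R i)"
proof -
  define S where "S = (SOME R. minimal_graded_free_resolution V I R)"
  have S: "minimal_graded_free_resolution V I S"
    unfolding S_def using assms by (rule someI)
  have "set (shifts S i) = set (shifts R i)"
    using minimal_resolution_shifts_subset[OF S, of R] minimal_resolution_shifts_subset[OF assms, of S]
      S assms by (auto simp: minimal_graded_free_resolution_def)
  then show ?thesis
    by (simp add: graded_betti_def S_def[symmetric] count_list_0_iff)
qed


section \<open>Powers of an ideal generated by a variable and a monomial\<close>

text \<open>Split off the term of \<open>p\<close> at \<open>s\<close>. By cancellation of
  exponents, the remaining part \<open>q\<close> cannot contribute at \<open>s + t\<close>.\<close>

lemma lookup_times_monomial: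
  fixes p :: "('v, 'k::field) mpoly"
  shows "Poly_Mapping.lookup (p * Poly_Mapping.single t 1) (s + t) = Poly_Mapping.lookup p s"
proof -
  define q where "q = p - Poly_Mapping.single s (Poly_Mapping.lookup p s)"
  have "s + t \<notin> Poly_Mapping.keys (q * Poly_Mapping.single t 1)"
  proof
    assume "s + t \<in> Poly_Mapping.keys (q * Poly_Mapping.single t 1)"
    then obtain a b where ab: "s + t = a + b" "a \<in> Poly_Mapping.keys q"
      "b \<in> Poly_Mapping.keys (Poly_Mapping.single t (1::'k))"
      using keys_mult[of q "Poly_Mapping.single t 1"] by auto
    then have "a = s" by simp
    with ab(2) show False by (simp add: q_def in_keys_iff lookup_minus)
  qed
  then have "Poly_Mapping.lookup (q * Poly_Mapping.single t 1) (s + t) = 0"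
    by (simp add: in_keys_iff)
  moreover have "p * Poly_Mapping.single t 1 =
      q * Poly_Mapping.single t 1 + Poly_Mapping.single (s + t) (Poly_Mapping.lookup p s)"
    by (simp add: q_def algebra_simps mult_single)
  ultimately show ?thesis by (simp add: lookup_add)
qed

lemma monomial_mult_eq_0:
  fixes p :: "('v, 'k::field) mpoly"
  assumes "p * Poly_Mapping.single t 1 = 0"
  shows "p = 0"
  by (rule poly_mapping_eqI) (metis assms lookup_times_monomial lookup_zero)

text \<open>Every monomial of the product is divisible by the variable \<open>c\<close>, and
  \<open>t\<close> is free of \<open>c\<close>, so \<open>c\<close> divides every monomial of
  \<open>p\<close>.\<close>

lemma var_dvd_cancel_monomial:
  fixes p q :: "('v, 'k::field) mpoly"
  assumes p: "p \<in> carrier (poly_ring V)" and eq: "p * Poly_Mapping.single t 1 = var c * q"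
    and t: "c \<notin> Poly_Mapping.keys t"
  obtains r where "r \<in> carrier (poly_ring V)" "p = var c * r"
proof -
  let ?e = "Poly_Mapping.single c (1::nat)"
  have c: "c \<in> Poly_Mapping.keys s" if s: "s \<in> Poly_Mapping.keys p" for s
  proof -
    have "s + t \<in> Poly_Mapping.keys (var c * q)"
      using s by (simp add: eq[symmetric] in_keys_iff lookup_times_monomial)
    then obtain a b where "s + t = a + b" "a \<in> Poly_Mapping.keys (var c :: ('v, 'k) mpoly)"
      using keys_mult[of "var c" q] by blast
    then have "s + t = ?e + b" by (simp add: var_def)
    then have "Poly_Mapping.lookup (s + t) c = Poly_Mapping.lookup (?e + b) c" by simp
    with t show ?thesis by (simp add: lookup_add in_keys_iff)
  qed
  \<comment> \<open>The coefficient of \<open>r\<close> at \<open>m\<close> is that of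
    \<open>p\<close> at \<open>m + ?e\<close>, so \<open>r\<close> is \<open>p\<close> divided by
    the variable \<open>c\<close>.\<close>
  define r where "r = Poly_Mapping.map_key (\<lambda>m. m + ?e) p"
  have inj: "inj (\<lambda>m. m + ?e)" by (simp add: inj_def)
  have lookup_r: "Poly_Mapping.lookup r m = Poly_Mapping.lookup p (m + ?e)" for m
    using map_key.rep_eq[OF inj, of p] by (simp add: r_def)
  have p_eq: "p = var c * r"
  proof (rule poly_mapping_eqI)
    fix s
    show "Poly_Mapping.lookup p s = Poly_Mapping.lookup (var c * r) s"
    proof (cases "c \<in> Poly_Mapping.keys s")
      case True
      then have s: "s = (s - ?e) + ?e"
        by (intro poly_mapping_eqI) (auto simp: lookup_add lookup_minus lookup_single when_def in_keys_iff)
      then have "Poly_Mapping.lookup (r * Poly_Mapping.single ?e 1) s = Poly_Mapping.lookup r (s - ?e)"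
        by (metis lookup_times_monomial)
      with s show ?thesis by (simp add: lookup_r var_def mult.commute)
    next
      case False
      have "s \<notin> Poly_Mapping.keys (var c * r)"
      proof
        assume "s \<in> Poly_Mapping.keys (var c * r)"
        then obtain a b where "s = a + b" "a \<in> Poly_Mapping.keys (var c :: ('v, 'k) mpoly)"
          using keys_mult[of "var c" r] by blast
        then have "s = ?e + b" by (simp add: var_def)
        with False show False by (simp add: in_keys_iff lookup_add)
      qed
      moreover have "s \<notin> Poly_Mapping.keys p" using False c by blast
      ultimately show ?thesis by (simp add: in_keys_iff)
    qed
  qed
  have "r \<in> carrier (poly_ring V)"
    unfolding poly_ring_def
  proof (clarsimp)
    fix m x assume m: "m \<in> Poly_Mapping.keys r" "x \<in> Poly_Mapping.keys m"
    then have "m + ?e \<in> Poly_Mapping.keys p" "x \<in> Poly_Mapping.keys (m + ?e)"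
      by (simp_all add: in_keys_iff lookup_r lookup_add)
    with p show "x \<in> V" by (auto simp: poly_ring_def)
  qed
  with p_eq that show ?thesis by blast
qed

text \<open>The star seen algebraically: a variable \<open>c\<close> for the centre and a monomial
  \<open>t\<close> of degree \<open>n\<close> prime to it for the product of the leaves.\<close>

locale star_monomials =
  fixes V :: "'v set" and c :: 'v and t :: "'v \<Rightarrow>\<^sub>0 nat" and n :: nat
  assumes c: "c \<in> V" and t: "Poly_Mapping.keys t \<subseteq> V" "c \<notin> Poly_Mapping.keys t" "monom_degree t = n"
    and n: "n \<ge> 1"
begin

abbreviation a :: "('v, 'k::field) mpoly" where "a \<equiv> var c"
abbreviation b :: "('v, 'k::field) mpoly" where "b \<equiv> Poly_Mapping.single t 1"

lemma a_closed: "(a :: ('v, 'k::field) mpoly) \<in> carrier (poly_ring V)"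
  using c by (simp add: var_def poly_ring_def)

lemma b_closed: "(b :: ('v, 'k::field) mpoly) \<in> carrier (poly_ring V)"
  using t by (simp add: poly_ring_def)

lemma a_homogeneous: "homogeneous 1 (a :: ('v, 'k::field) mpoly)"
  by (simp add: homogeneous_def var_def monom_degree_def)

lemma b_homogeneous: "homogeneous (int n) (b :: ('v, 'k::field) mpoly)"
  using t by (simp add: homogeneous_def)

text \<open>Since \<open>n >= 1\<close>, some variable divides the monomial. Minimality of the
  resolution rests on this.\<close>

lemma b_irrelevant: "(b :: ('v, 'k::field) mpoly) \<in> irrelevant_ideal V"
proof -
  obtain x where x: "x \<in> Poly_Mapping.keys t"
    using n t(3) by (fastforce simp: monom_degree_def)
  let ?e = "Poly_Mapping.single x (1::nat)"
  have "t = (t - ?e) + ?e"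
    using x by (intro poly_mapping_eqI) (auto simp: lookup_add lookup_minus lookup_single when_def in_keys_iff)
  then have b: "b = Poly_Mapping.single (t - ?e) 1 * (var x :: ('v, 'k) mpoly)"
    by (metis mult_1 mult_single var_def)
  have "Poly_Mapping.keys (t - ?e) \<subseteq> V"
    using t(1) by (auto simp: in_keys_iff lookup_minus)
  then have "Poly_Mapping.single (t - ?e) (1::'k) \<in> carrier (poly_ring V)"
    by (simp add: poly_ring_def)
  from ideal.I_l_closed[OF ideal_irrelevant_ideal var_irrelevant this]
  show ?thesis using x t(1) b by auto
qed

text \<open>For \<open>l <= k\<close>, the degree of the generator
  \<open>a ^ l * b ^ (k - l)\<close>. The syzygy linking generators \<open>l\<close> and
  \<open>Suc l\<close> has degree one more.\<close>

definition shift :: "nat \<Rightarrow> nat \<Rightarrow> int" where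
  "shift k l = int l + int n * (int k - int l)"

text \<open>The Hilbert--Burch resolution of \<open>(a, b)\<^sup>k\<close>.\<close>

definition power_res :: "nat \<Rightarrow> ('v, 'k::field) mpoly graded_complex" where
  "power_res k = \<lparr>
    shifts = (\<lambda>i. if i = 0 then map (shift k) [0..<Suc k]
      else if i = 1 then map (\<lambda>l. 1 + shift k l) [0..<k] else []),
    aug = (\<lambda>l. a ^ l * b ^ (k - l)),
    diff = (\<lambda>_ l m. if m = l then a else if m = Suc l then - b else 0)\<rparr>"

lemma rnk_power_res:
  "rnk (power_res k) 0 = Suc k" "rnk (power_res k) (Suc 0) = k" "rnk (power_res k) (Suc (Suc i)) = 0"
  by (simp_all add: rnk_def power_res_def)

lemma aug_power_res [simp]: "aug (power_res k) l = a ^ l * b ^ (k - l)"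
  by (simp add: power_res_def)

lemma diff_map_power_res:
  fixes v :: "nat \<Rightarrow> ('v, 'k::field) mpoly"
  assumes "v \<in> free_module V k"
  shows "diff_map (power_res k) 0 v = (\<lambda>m. a * v m - (case m of 0 \<Rightarrow> 0 | Suc l \<Rightarrow> b * v l))"
proof
  fix m
  \<comment> \<open>The vanishing from index \<open>k\<close> on makes the formula valid at the last
    coordinate \<open>m = k\<close>, which only syzygy \<open>k - 1\<close> reaches, and beyond
    it.\<close>
  have v: "v l = 0" if "l \<ge> k" for l
    using assms that by (simp add: free_module_def)
  have summand: "v l * diff (power_res k) 0 l m =
      (if l = m then a * v m else 0) - (if m = Suc l then b * v l else 0)" for l
    by (simp add: power_res_def mult.commute)
  have 1: "(\<Sum>l<k. if l = m then a * v m else 0) = a * v m"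
    using v by simp
  have 2: "(\<Sum>l<k. if m = Suc l then b * v l else 0) = (case m of 0 \<Rightarrow> 0 | Suc l \<Rightarrow> b * v l)"
    using v by (cases m) auto
  show "diff_map (power_res k) 0 v m = a * v m - (case m of 0 \<Rightarrow> 0 | Suc l \<Rightarrow> b * v l)"
    using v by (auto simp: diff_map_def rnk_power_res summand sum_subtractf 1 2 split: nat.splits)
qed

lemma aug_map_power_res: "aug_map (power_res k) v = (\<Sum>l\<le>k. v l * (a ^ l * b ^ (k - l)))"
  by (simp add: aug_map_def rnk_power_res lessThan_Suc_atMost)

section \<open>Exactness of the complex\<close>

lemma a_mult_eq_0: "a * p = 0 \<Longrightarrow> p = (0 :: ('v, 'k::field) mpoly)"
  unfolding var_def by (metis monomial_mult_eq_0 mult.commute)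

lemma b_power: "b ^ j = (Poly_Mapping.single (\<Sum>i<j. t) 1 :: ('v, 'k::field) mpoly)"
  by (induction j) (simp_all add: mult_single add.commute)

lemma a_dvd_cancel_b_power:
  fixes p :: "('v, 'k::field) mpoly"
  assumes "p \<in> carrier (poly_ring V)" "p * b ^ j = a * q"
  obtains r where "r \<in> carrier (poly_ring V)" "p = a * r"
proof -
  have "c \<notin> Poly_Mapping.keys (\<Sum>i<j. t)"
    using t(2) by (simp add: in_keys_iff lookup_sum)
  with var_dvd_cancel_monomial[OF assms(1), of "\<Sum>i<j. t" c q] assms(2) that show ?thesis
    unfolding b_power by blast
qed

text \<open>All terms except the one with index 0 contain \<open>a\<close>, so \<open>a\<close>
  divides \<open>v 0 * b ^ Suc k\<close> and hence \<open>v 0\<close>. Subtracting a multiple of the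
  first linking syzygy and dividing by \<open>a\<close> leaves a relation for the next smaller
  power.\<close>

lemma power_syzygy:
  fixes v :: "nat \<Rightarrow> ('v, 'k::field) mpoly"
  assumes "v \<in> free_module V (Suc k)" "(\<Sum>l\<le>k. v l * (a ^ l * b ^ (k - l))) = 0"
  shows "\<exists>w \<in> free_module V k. v = (\<lambda>m. a * w m - (case m of 0 \<Rightarrow> 0 | Suc l \<Rightarrow> b * w l))"
  using assms
proof (induction k arbitrary: v)
  case 0
  then have "v l = 0" for l by (cases l) (simp_all add: free_module_def)
  then have "v = (\<lambda>_. 0)" by auto
  then show ?case
    by (intro bexI[of _ "\<lambda>_. 0"] zero_free_module) (auto simp: fun_eq_iff split: nat.splits)
next
  case (Suc k)
  let ?S = "\<Sum>l\<le>k. v (Suc l) * (a ^ l * b ^ (k - l))"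
  have sum_eq: "v 0 * b ^ Suc k + a * ?S = 0"
    using Suc.prems(2) unfolding sum.atMost_Suc_shift by (simp add: sum_distrib_left algebra_simps)
  then have "v 0 * b ^ Suc k = a * (- ?S)"
    by (simp add: eq_neg_iff_add_eq_0)
  moreover have "v 0 \<in> carrier (poly_ring V)"
    using Suc.prems(1) by (simp add: free_module_def)
  ultimately obtain r where r: "r \<in> carrier (poly_ring V)" "v 0 = a * r"
    using a_dvd_cancel_b_power by blast
  from sum_eq have "a * (r * b ^ Suc k + ?S) = 0"
    by (simp add: r(2) algebra_simps)
  then have S: "r * b ^ Suc k + ?S = 0" by (rule a_mult_eq_0)
  \<comment> \<open>Subtracting \<open>r\<close> times the first syzygy clears \<open>v 0\<close>
    and adds \<open>b * r\<close> to the next entry; the indices then move down by one.\<close>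
  define v' where "v' l = v (Suc l) + (if l = 0 then b * r else 0)" for l
  have "v' \<in> free_module V (Suc k)"
    using Suc.prems(1) r(1) b_closed
    by (auto simp: v'_def free_module_def intro!: poly_ring_closed)
  moreover have "(\<Sum>l\<le>k. v' l * (a ^ l * b ^ (k - l))) = 0"
  proof -
    have "(\<Sum>l\<le>k. v' l * (a ^ l * b ^ (k - l))) =
        ?S + (\<Sum>l\<le>k. if l = 0 then b * r * (a ^ l * b ^ (k - l)) else 0)"
      unfolding sum.distrib[symmetric] by (rule sum.cong) (auto simp: v'_def algebra_simps)
    also have "\<dots> = r * b ^ Suc k + ?S" by (simp add: algebra_simps)
    finally show ?thesis using S by simp
  qed
  ultimately obtain w' where w': "w' \<in> free_module V k"
    "v' = (\<lambda>m. a * w' m - (case m of 0 \<Rightarrow> 0 | Suc l \<Rightarrow> b * w' l))"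
    using Suc.IH by blast
  \<comment> \<open>The coefficient \<open>r\<close> of the first syzygy is put in front of those
    found by induction.\<close>
  define w where "w = case_nat r w'"
  have "w \<in> free_module V (Suc k)"
    using w'(1) r(1) by (auto simp: w_def free_module_def split: nat.splits)
  moreover have "v m = a * w m - (case m of 0 \<Rightarrow> 0 | Suc l \<Rightarrow> b * w l)" for m
  proof (cases m)
    case 0
    then show ?thesis by (simp add: w_def r(2))
  next
    case (Suc l)
    have "v (Suc l) = v' l - (if l = 0 then b * r else 0)" by (simp add: v'_def)
    then show ?thesis unfolding w'(2) Suc by (cases l) (auto simp: w_def)
  qed
  ultimately show ?case by (intro bexI[of _ w]) auto
qed

text \<open>The system is triangular with the nonzerodivisor \<open>a\<close> on the diagonal, so
  the entries vanish one after the other.\<close>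

lemma power_diff_injective:
  fixes v :: "nat \<Rightarrow> ('v, 'k::field) mpoly"
  assumes "(\<lambda>m. a * v m - (case m of 0 \<Rightarrow> 0 | Suc l \<Rightarrow> b * v l)) = (\<lambda>_. 0)"
  shows "v = (\<lambda>_. 0)"
proof
  fix m
  show "v m = 0"
  proof (induction m)
    case 0
    show ?case using fun_cong[OF assms, of 0] by (auto intro: a_mult_eq_0)
  next
    case (Suc m)
    then show ?case using fun_cong[OF assms, of "Suc m"] by (auto intro: a_mult_eq_0)
  qed
qed

text \<open>The two contributions of each linking syzygy cancel, because \<open>a\<close> times
  generator \<open>l\<close> equals \<open>b\<close> times generator \<open>Suc l\<close>.\<close>

lemma power_res_complex:
  fixes v :: "nat \<Rightarrow> ('v, 'k::field) mpoly"
  assumes "v \<in> free_module V k"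
  shows "diff_map (power_res k) 0 v \<in> free_module V (Suc k)"
    and "aug_map (power_res k) (diff_map (power_res k) 0 v) = 0"
proof -
  have v: "v m \<in> carrier (poly_ring V)" "m \<ge> k \<Longrightarrow> v m = 0" for m
    using assms by (cases "m < k"; simp add: free_module_def poly_ring_closed)+
  show "diff_map (power_res k) 0 v \<in> free_module V (Suc k)"
    unfolding diff_map_power_res[OF assms] using v a_closed b_closed
    by (auto simp: free_module_def intro!: poly_ring_closed split: nat.splits)
  have 1: "(\<Sum>l\<le>k. a * v l * (a ^ l * b ^ (k - l))) = (\<Sum>l<k. v l * (a ^ Suc l * b ^ (k - l)))"
    unfolding lessThan_Suc_atMost[symmetric] using v(2)[of k] by (simp add: algebra_simps)
  have 2: "(\<Sum>l\<le>k. (case l of 0 \<Rightarrow> 0 | Suc l \<Rightarrow> b * v l) * (a ^ l * b ^ (k - l))) =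
      (\<Sum>l<k. v l * (a ^ Suc l * b ^ (k - l)))"
  proof -
    have "(\<Sum>l\<le>k. (case l of 0 \<Rightarrow> 0 | Suc l \<Rightarrow> b * v l) * (a ^ l * b ^ (k - l))) =
        (\<Sum>l<k. b * v l * (a ^ Suc l * b ^ (k - Suc l)))"
      unfolding lessThan_Suc_atMost[symmetric] sum.lessThan_Suc_shift by simp
    also have "\<dots> = (\<Sum>l<k. v l * (a ^ Suc l * b ^ (k - l)))"
    proof (rule sum.cong)
      fix l assume "l \<in> {..<k}"
      then have "b ^ (k - l) = (b * b ^ (k - Suc l) :: ('v, 'k) mpoly)"
        by (simp flip: power_Suc add: Suc_diff_Suc)
      then show "b * v l * (a ^ Suc l * b ^ (k - Suc l)) = v l * (a ^ Suc l * b ^ (k - l))"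
        by (simp add: algebra_simps)
    qed simp
    finally show ?thesis .
  qed
  show "aug_map (power_res k) (diff_map (power_res k) 0 v) = 0"
    unfolding aug_map_power_res diff_map_power_res[OF assms] left_diff_distrib sum_subtractf 1 2
    by simp
qed

lemma minimal_power_res:
  fixes I :: "('v, 'k::field) mpoly set"
  assumes I: "aug_map (power_res k) ` free_module V (Suc k) = I"
  shows "minimal_graded_free_resolution V I (power_res k)"
proof -
  let ?R = "power_res k :: ('v, 'k) mpoly graded_complex"
  have zero_module: "free_module V 0 = {\<lambda>_. 0 :: ('v, 'k) mpoly}"
    by (auto simp: free_module_def)
  have aug: "aug ?R l \<in> carrier (poly_ring V) \<and> homogeneous (shifts ?R 0 ! l) (aug ?R l)"
    if "l < rnk ?R 0" for l
  proof -
    have l: "l < Suc k" using that by (simp add: rnk_power_res)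
    have "shifts ?R 0 ! l = int l * 1 + int (k - l) * int n"
      using l by (simp add: power_res_def shift_def nth_append del: upt_Suc)
    then show ?thesis
      by (auto intro!: poly_ring_closed a_closed b_closed homogeneous_mult[OF homogeneous_power homogeneous_power]
          a_homogeneous b_homogeneous)
  qed
  have diff: "diff ?R i l m \<in> carrier (poly_ring V) \<and>
      homogeneous (shifts ?R (Suc i) ! l - shifts ?R i ! m) (diff ?R i l m) \<and>
      diff ?R i l m \<in> irrelevant_ideal V"
    if "l < rnk ?R (Suc i)" "m < rnk ?R i" for i l m
  proof -
    \<comment> \<open>All modules beyond homological degree one are zero, so only one matrix has
      entries to be checked.\<close>
    have i: "i = 0" using that(1) by (cases i) (simp_all add: rnk_power_res)
    have lm: "l < k" "m < Suc k" using that by (simp_all add: i rnk_power_res)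
    have "shifts ?R (Suc i) ! l - shifts ?R i ! m = 1 + shift k l - shift k m"
      using lm by (simp add: i power_res_def del: upt_Suc)
    moreover have "1 + shift k l - shift k (Suc l) = int n"
      by (simp add: shift_def algebra_simps)
    moreover have "- b \<in> (irrelevant_ideal V :: ('v, 'k) mpoly set)"
      using ideal.I_l_closed[OF ideal_irrelevant_ideal b_irrelevant, of "- 1"]
      by (simp add: poly_ring_closed)
    moreover have "0 \<in> (irrelevant_ideal V :: ('v, 'k) mpoly set)"
      using additive_subgroup.zero_closed[OF ideal.axioms(1)[OF ideal_irrelevant_ideal]] by simp
    moreover have "a \<in> (irrelevant_ideal V :: ('v, 'k) mpoly set)"
      by (rule var_irrelevant[OF c])
    ultimately show ?thesis
      using a_homogeneous homogeneous_uminus[OF b_homogeneous] a_closed b_closed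
      by (auto simp: power_res_def intro: poly_ring_closed)
  qed
  have ker0: "{v \<in> free_module V (rnk ?R 0). aug_map ?R v = 0} = diff_map ?R 0 ` free_module V (rnk ?R 1)"
  proof (intro equalityI subsetI)
    fix v :: "nat \<Rightarrow> ('v, 'k) mpoly" assume "v \<in> {v \<in> free_module V (rnk ?R 0). aug_map ?R v = 0}"
    then obtain w where "w \<in> free_module V k"
      "v = (\<lambda>m. a * w m - (case m of 0 \<Rightarrow> 0 | Suc l \<Rightarrow> b * w l))"
      using power_syzygy[of v k] by (auto simp: rnk_power_res aug_map_power_res)
    then show "v \<in> diff_map ?R 0 ` free_module V (rnk ?R 1)"
      using diff_map_power_res[of w k] by (metis One_nat_def imageI rnk_power_res(2))
  qed (auto simp: rnk_power_res power_res_complex)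
  have ker: "{v \<in> free_module V (rnk ?R (Suc i)). diff_map ?R i v = (\<lambda>_. 0)} =
      diff_map ?R (Suc i) ` free_module V (rnk ?R (Suc (Suc i)))" for i
  proof -
    \<comment> \<open>For \<open>i = 0\<close> this is injectivity of the only nontrivial
      differential; for larger \<open>i\<close> the module itself is zero.\<close>
    have "{v \<in> free_module V (rnk ?R (Suc i)). diff_map ?R i v = (\<lambda>_. 0)} = {\<lambda>_. 0}"
    proof (cases i)
      case 0
      have "v = (\<lambda>_. 0)" if "v \<in> free_module V k" "diff_map ?R 0 v = (\<lambda>_. 0)" for v
        using that(2) unfolding diff_map_power_res[OF that(1)] by (rule power_diff_injective)
      then show ?thesis using 0 zero_free_module by (auto simp: rnk_power_res diff_map_lin)
    next
      case (Suc j)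
      then show ?thesis by (auto simp: rnk_power_res zero_module diff_map_lin)
    qed
    then show ?thesis by (simp add: rnk_power_res zero_module diff_map_lin)
  qed
  show ?thesis
    unfolding minimal_graded_free_resolution_def graded_free_resolution_def graded_maps_def
    using aug diff ker0 ker I by (simp add: rnk_power_res(1))
qed

end

section \<open>Identification with the powers of the ideal, and their regularity\<close>

context star_monomials
begin

text \<open>Taken as the image of the augmentation, so that the complex resolves it directly; that
  it is the \<open>k\<close>-th power of \<open>(a, b)\<close> is shown afterwards.\<close>

definition power_ideal :: "nat \<Rightarrow> ('v, 'k::field) mpoly set" where
  "power_ideal k = aug_map (power_res k) ` free_module V (Suc k)"

lemma ideal_power_ideal: "ideal (power_ideal k :: ('v, 'k::field) mpoly set) (poly_ring V)"
proof (rule poly_ring_idealI)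
  show "(power_ideal k :: ('v, 'k) mpoly set) \<subseteq> carrier (poly_ring V)"
    using a_closed b_closed
    by (auto simp: power_ideal_def aug_map_power_res free_module_def
        intro!: poly_ring_sum_closed poly_ring_closed)
  show "0 \<in> (power_ideal k :: ('v, 'k) mpoly set)"
    unfolding power_ideal_def
    by (rule image_eqI[OF _ zero_free_module]) (simp add: aug_map_power_res)
next
  fix p q :: "('v, 'k) mpoly" assume "p \<in> power_ideal k" "q \<in> power_ideal k"
  then obtain v w where vw: "v \<in> free_module V (Suc k)" "w \<in> free_module V (Suc k)"
    "p = aug_map (power_res k) v" "q = aug_map (power_res k) w"
    by (auto simp: power_ideal_def)
  then have "(\<lambda>l. v l + w l) \<in> free_module V (Suc k)"
    by (auto simp: free_module_def intro: poly_ring_closed)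
  moreover have "p + q = aug_map (power_res k) (\<lambda>l. v l + w l)"
    using vw by (simp add: aug_map_power_res distrib_right sum.distrib)
  ultimately show "p + q \<in> power_ideal k" unfolding power_ideal_def by blast
next
  fix p q :: "('v, 'k) mpoly" assume p: "p \<in> carrier (poly_ring V)" and "q \<in> power_ideal k"
  then obtain v where v: "v \<in> free_module V (Suc k)" "q = aug_map (power_res k) v"
    by (auto simp: power_ideal_def)
  then have "(\<lambda>l. p * v l) \<in> free_module V (Suc k)"
    using p by (auto simp: free_module_def intro: poly_ring_closed)
  moreover have "p * q = aug_map (power_res k) (\<lambda>l. p * v l)"
    using v by (simp add: aug_map_power_res sum_distrib_left mult.assoc)
  ultimately show "p * q \<in> power_ideal k" unfolding power_ideal_def by blast
qed

lemma generator_mem_power_ideal: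
  assumes "l \<le> k"
  shows "a ^ l * b ^ (k - l) \<in> (power_ideal k :: ('v, 'k::field) mpoly set)"
proof -
  have "aug_map (power_res k) (unit_vec l) = (a ^ l * b ^ (k - l) :: ('v, 'k) mpoly)"
    using assms by (simp add: aug_map_unit_vec rnk_power_res)
  with unit_vec_closed[of l "Suc k" V] assms show ?thesis
    unfolding power_ideal_def by (metis imageI less_Suc_eq_le)
qed

lemma power_ideal_subset:
  fixes I :: "('v, 'k::field) mpoly set"
  assumes "ideal I (poly_ring V)" "\<And>l. l \<le> k \<Longrightarrow> a ^ l * b ^ (k - l) \<in> I"
  shows "power_ideal k \<subseteq> I"
proof -
  have "v l * (a ^ l * b ^ (k - l)) \<in> I" if "v \<in> free_module V (Suc k)" "l \<le> k" for v l
    using that by (intro poly_ring_idealD(4)[OF assms(1)] assms(2)) (simp_all add: free_module_def)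
  then show ?thesis
    by (auto simp: power_ideal_def aug_map_power_res intro!: poly_ring_ideal_sum[OF assms(1)])
qed

lemma power_ideal_1:
  "power_ideal 1 = genideal (poly_ring V) {a, b :: ('v, 'k::field) mpoly}"
proof (rule equalityI)
  have closed: "{a, b :: ('v, 'k) mpoly} \<subseteq> carrier (poly_ring V)"
    using a_closed b_closed by simp
  show "power_ideal 1 \<subseteq> genideal (poly_ring V) {a, b :: ('v, 'k) mpoly}"
  proof (rule power_ideal_subset[OF poly_ring.genideal_ideal[OF closed]])
    fix l :: nat assume "l \<le> 1"
    then have "a ^ l * b ^ (1 - l) \<in> {a, b :: ('v, 'k) mpoly}" by (cases l) auto
    then show "a ^ l * b ^ (1 - l) \<in> genideal (poly_ring V) {a, b :: ('v, 'k) mpoly}"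
      using poly_ring.genideal_self[OF closed] by blast
  qed
  have "{a, b :: ('v, 'k) mpoly} \<subseteq> power_ideal 1"
    using generator_mem_power_ideal[of 0 1] generator_mem_power_ideal[of 1 1] by simp
  then show "genideal (poly_ring V) {a, b :: ('v, 'k) mpoly} \<subseteq> power_ideal 1"
    by (rule poly_ring.genideal_minimal[OF ideal_power_ideal])
qed

text \<open>Both inclusions reduce to generators: products of generators are generators of the next
  power, and each of these factors off one \<open>a\<close> or one \<open>b\<close>.\<close>

lemma power_ideal_Suc:
  "ideal_prod (poly_ring V) (power_ideal k) (power_ideal 1) =
    (power_ideal (Suc k) :: ('v, 'k::field) mpoly set)"
proof (rule equalityI)
  let ?I = "power_ideal (Suc k) :: ('v, 'k) mpoly set"
  have gens: "a ^ l * b ^ (k - l) * (a ^ m * b ^ (1 - m)) \<in> ?I" if "l \<le> k" "m \<le> 1" for l m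
  proof -
    have "a ^ l * b ^ (k - l) * (a ^ m * b ^ (1 - m)) = (a ^ (l + m) * b ^ (k - l + (1 - m)) :: ('v, 'k) mpoly)"
      by (simp add: power_add)
    also have "k - l + (1 - m) = Suc k - (l + m)" using that by simp
    finally show ?thesis using generator_mem_power_ideal[of "l + m" "Suc k"] that by simp
  qed
  \<comment> \<open>With a generator of the first factor fixed, an ideal quotient extends the claim
    to all of the second factor; a second quotient then extends it to all of the first.\<close>
  have "power_ideal 1 \<subseteq>
      {q \<in> carrier (poly_ring V). \<forall>p \<in> {a ^ l * b ^ (k - l)}. q * p \<in> ?I}" if "l \<le> k" for l
    using gens[OF that] a_closed b_closed
    by (intro power_ideal_subset colon_ideal ideal_power_ideal)
      (auto intro: poly_ring_closed simp: mult.commute)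
  then have "power_ideal k \<subseteq> {p \<in> carrier (poly_ring V). \<forall>q \<in> power_ideal 1. p * q \<in> ?I}"
    using a_closed b_closed
    by (intro power_ideal_subset colon_ideal ideal_power_ideal)
      (auto intro: poly_ring_closed simp: mult.commute)
  then have mult: "p * q \<in> ?I" if "p \<in> power_ideal k" "q \<in> power_ideal 1" for p q
    using that by blast
  show "ideal_prod (poly_ring V) (power_ideal k) (power_ideal 1) \<subseteq> ?I"
  proof
    fix x :: "('v, 'k) mpoly"
    assume "x \<in> ideal_prod (poly_ring V) (power_ideal k) (power_ideal 1)"
    then show "x \<in> ?I"
      by (induction rule: ideal_prod.induct)
        (simp_all add: mult poly_ring_idealD(3)[OF ideal_power_ideal])
  qed
next
  let ?P = "ideal_prod (poly_ring V) (power_ideal k) (power_ideal 1) :: ('v, 'k) mpoly set"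
  show "power_ideal (Suc k) \<subseteq> ?P"
  proof (rule power_ideal_subset)
    show "ideal ?P (poly_ring V)"
      by (rule poly_ring.ideal_prod_is_ideal[OF ideal_power_ideal ideal_power_ideal])
  next
    fix l assume l: "l \<le> Suc k"
    have prod: "p * q \<in> ?P" if "p \<in> power_ideal k" "q \<in> power_ideal 1" for p q
      using ideal_prod.prod[OF that, of "poly_ring V"] by simp
    show "a ^ l * b ^ (Suc k - l) \<in> ?P"
    \<comment> \<open>A factor \<open>b\<close> can be split off unless the generator is the pure
      power of \<open>a\<close>.\<close>
    proof (cases "l \<le> k")
      case True
      then have "a ^ l * b ^ (Suc k - l) = a ^ l * b ^ (k - l) * (a ^ 0 * b ^ (1 - 0) :: ('v, 'k) mpoly)"
        by (simp add: Suc_diff_le)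
      then show ?thesis
        using prod[OF generator_mem_power_ideal[OF True] generator_mem_power_ideal[of 0 1]] by simp
    next
      case False
      with l have "l = Suc k" by simp
      then have "a ^ l * b ^ (Suc k - l) = a ^ k * b ^ (k - k) * (a ^ 1 * b ^ (1 - 1) :: ('v, 'k) mpoly)"
        by simp
      then show ?thesis
        using prod[OF generator_mem_power_ideal[of k k] generator_mem_power_ideal[of 1 1]] by simp
    qed
  qed
qed

lemma power_ideal_eq:
  "(power_ideal 1 :: ('v, 'k::field) mpoly set) [^]\<^bsub>ideals_set (poly_ring V)\<^esub> k = power_ideal k"
proof (induction k)
  case 0
  \<comment> \<open>The zeroth power is the unit of the monoid of ideals, that is, the whole
    ring.\<close>
  have "1 \<in> (power_ideal 0 :: ('v, 'k) mpoly set)"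
    using generator_mem_power_ideal[of 0 0] by simp
  then have "carrier (poly_ring V) \<subseteq> (power_ideal 0 :: ('v, 'k) mpoly set)"
    using poly_ring_idealD(4)[OF ideal_power_ideal, of _ 1] by (metis mult.right_neutral subsetI)
  then show ?case
    using poly_ring_idealD(1)[OF ideal_power_ideal] by (auto simp: ideals_set_def)
next
  case (Suc k)
  then show ?case
    by (simp add: nat_pow_def ideals_set_def power_ideal_Suc[unfolded One_nat_def])
qed

lemma regularity_power_ideal:
  "regularity V (power_ideal k :: ('v, 'k::field) mpoly set) = int (k * n)"
proof -
  have res: "minimal_graded_free_resolution V (power_ideal k) (power_res k :: ('v, 'k) mpoly graded_complex)"
    by (rule minimal_power_res) (simp add: power_ideal_def)
  have "{j - int i | i j. graded_betti V (power_ideal k :: ('v, 'k) mpoly set) i j \<noteq> 0} =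
      {j - int i | i j. j \<in> set (shifts (power_res k :: ('v, 'k) mpoly graded_complex) i)}"
    by (simp only: graded_betti_nonzero_iff[OF res])
  \<comment> \<open>In homological degree one the shifts \<open>1 + shift k l\<close> lose 1 again,
    so the syzygies contribute values already attained by generators.\<close>
  also have "\<dots> = shift k ` {..k}"
  proof (intro equalityI subsetI)
    fix x assume "x \<in> shift k ` {..k}"
    then obtain l where "l \<in> {0..<Suc k}" "x = shift k l - int 0"
      by (metis atLeast0LessThan diff_zero image_iff lessThan_Suc_atMost of_nat_0)
    then show "x \<in> {j - int i | i j. j \<in> set (shifts (power_res k :: ('v, 'k) mpoly graded_complex) i)}"
      by (intro CollectI exI[of _ "0 :: nat"] exI[of _ "shift k l"]) (auto simp: power_res_def simp del: upt_Suc)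
  qed (auto simp: power_res_def split: if_splits)
  finally have "regularity V (power_ideal k :: ('v, 'k) mpoly set) = Max (shift k ` {..k})"
    by (simp add: regularity_def)
  also have "\<dots> = int (k * n)"
  proof (rule Max_eqI)
    fix y assume "y \<in> shift k ` {..k}"
    then obtain l where "l \<le> k" "y = int l + int n * (int k - int l)" by (auto simp: shift_def)
    \<comment> \<open>As \<open>n >= 1\<close>, replacing a factor \<open>b\<close> by
      \<open>a\<close> cannot raise the degree, so the maximum is at \<open>l = 0\<close>.\<close>
    moreover have "1 * int l \<le> int n * int l"
      using n by (intro mult_right_mono) simp_all
    ultimately show "y \<le> int (k * n)" by (simp add: algebra_simps)
  next
    show "int (k * n) \<in> shift k ` {..k}"
      by (rule image_eqI[of _ _ 0]) (simp_all add: shift_def)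
  qed simp
  finally show ?thesis .
qed

end


section \<open>The cover ideal of a star\<close>

lemma prod_var:
  "finite C \<Longrightarrow> (\<Prod>x\<in>C. var x) = (Poly_Mapping.single (\<Sum>x\<in>C. Poly_Mapping.single x 1) 1 :: ('v, 'k::field) mpoly)"
  by (induction C rule: finite_induct) (simp_all add: var_def mult_single)

text \<open>A cover missing the centre must contain every leaf, so each cover contains
  \<open>{c}\<close> or \<open>L\<close>. These two are incomparable because \<open>L\<close> is
  nonempty and avoids \<open>c\<close>.\<close>

lemma minimal_vertex_cover_star:
  assumes "verts G = insert c L" "c \<notin> L" "L \<noteq> {}" "arcs_ends G = {c} \<times> L \<union> L \<times> {c}"
  shows "minimal_vertex_cover G C \<longleftrightarrow> C = {c} \<or> C = L"
proof -
  have cover: "vertex_cover G D \<longleftrightarrow> D \<subseteq> insert c L \<and> (c \<in> D \<or> L \<subseteq> D)" for D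
    using assms by (auto simp: vertex_cover_def)
  show ?thesis
    unfolding minimal_vertex_cover_def cover
  proof (intro iffI conjI)
    assume *: "(C \<subseteq> insert c L \<and> (c \<in> C \<or> L \<subseteq> C)) \<and>
      (\<forall>D. D \<subset> C \<longrightarrow> \<not> (D \<subseteq> insert c L \<and> (c \<in> D \<or> L \<subseteq> D)))"
    then have "\<not> {c} \<subset> C" "\<not> L \<subset> C" by auto
    with * show "C = {c} \<or> C = L" by blast
  qed (use assms in auto)
qed

theorem corollary3p5:
  fixes G :: "('v, 'e) pre_digraph" and n k :: nat
  assumes "n \<ge> 1" and "complete_bipartite_digraph 1 n G" and "k \<ge> 1"
  shows "regularity (verts G)
           ((cover_ideal G :: ('v, 'k::field) mpoly set) [^]\<^bsub>ideals_set (poly_ring (verts G))\<^esub> k)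
         = int (k * n)"
proof -
  from assms(2) obtain U L where UL: "verts G = U \<union> L" "U \<inter> L = {}" "card U = 1" "card L = n"
    "arcs_ends G = U \<times> L \<union> L \<times> U"
    by (auto simp: complete_bipartite_digraph_def)
  then obtain c where U: "U = {c}" by (auto simp: card_1_singleton_iff)
  have L: "finite L" "L \<noteq> {}" "c \<notin> L"
    using UL U assms(1) by (auto simp: card_gt_0_iff intro: card_ge_0_finite)
  \<comment> \<open>The exponent of the product of all leaves. It is squarefree, so its degree is
    the number \<open>n\<close> of leaves.\<close>
  define t where "t = (\<Sum>x\<in>L. Poly_Mapping.single x (1::nat))"
  have lookup_t: "Poly_Mapping.lookup t x = (if x \<in> L then 1 else 0)" for x
    using L(1) by (simp add: t_def lookup_sum lookup_single when_def)
  then have keys_t: "Poly_Mapping.keys t = L"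
    by (auto simp: in_keys_iff split: if_splits)
  interpret star_monomials "verts G" c t n
  proof
    show "monom_degree t = n"
      by (simp add: monom_degree_def keys_t lookup_t UL(4))
  qed (use UL U L keys_t assms(1) in auto)
  have "minimal_vertex_cover G C \<longleftrightarrow> C = {c} \<or> C = L" for C
    by (rule minimal_vertex_cover_star) (use UL(1,5) L in \<open>simp_all add: U\<close>)
  then have "{\<Prod>x\<in>C. var x | C. minimal_vertex_cover G C} = {var c, \<Prod>x\<in>L. var x :: ('v, 'k) mpoly}"
    by (auto intro: exI[of _ "{c}"])
  then have "cover_ideal G = (power_ideal 1 :: ('v, 'k) mpoly set)"
    unfolding cover_ideal_def power_ideal_1 by (simp add: prod_var[OF L(1)] t_def)
  then show ?thesis
    by (simp only: power_ideal_eq regularity_power_ideal)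
qed

end
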